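(* Let $d\geq 1$ and let $f:[0,4]\to\mathbb{R}$ be continuous on $[0,4]$ and such that $f+c$ is completely monotone on $(0,4]$ for some constant $c\in\mathbb{R}$. Let $\overline{\omega}_N\subset S^d$ be an $N$-point configuration which is either strongly $m$-sharp for some $m\ge1$ or antipodal and $m$-sharp for some $m\ge 1$. Then $$Q_f(\overline{\omega}_N;S^d)\le Q_f(\omega_N;S^d)$$ for every $N$-point configuration (multiset, points may repeat) $\omega_N\subset S^d$. If in addition $f+c$ is strictly completely monotone on $(0,4]$ for some constant $c$, and $\omega_N$ is an $N$-point multiset on $S^d$ for which equality holds, then $\omega_N$ is sharp (in particular consists of distinct points) and the set of dot products between distinct points of $\omega_N$ coincides with the set of dot products between distinct points of $\overline{\omega}_N$.
   Context: $S^d$ is the unit sphere in $\mathbb{R}^{d+1}$, $\sigma_d$ its normalized surface measure. For a multiset $\omega_N=\{\mathbf{x}_1,\dots,\mathbf{x}_N\}\subset S^d$, $p_f(\mathbf{x},\omega_N)=\sum_{i=1}^N f(|\mathbf{x}-\mathbf{x}_i|^2)$ and $Q_f(\omega_N;S^d)=\max_{\mathbf{x}\in S^d}p_f(\mathbf{x},\omega_N)$. A function $h$ is completely monotone on an interval $I$ if it is infinitely differentiable there and $(-1)^kh^{(k)}\ge0$ on $I$ for all $k\ge0$; strictly completely monotone if moreover $(-1)^kh^{(k)}>0$ in the interior of $I$ for all $k\ge 0$. A spherical $n$-design is a configuration with $\frac1N\sum_i p(\mathbf{x}_i)=\int_{S^d}p\,d\sigma_d$ for all polynomials $p$ of degree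 $\le n$. A configuration of $N$ distinct points is $m$-sharp if it is a spherical $(2m-1)$-design and exactly $m$ distinct dot products occur between distinct points; strongly $m$-sharp if moreover it is a spherical $2m$-design; sharp if it is $m$-sharp for some $m$; antipodal if it is closed under $\mathbf{x}\mapsto-\mathbf{x}$. *)

theory Defs
  imports "HOL-Analysis.Analysis"
begin

text \<open>Points of the sphere S^d live in real^'n with CARD('n) = d+1.
  An N-point configuration (multiset) is an indexed family x :: nat => real^'n, indices i < N.\<close>

definition on_sphere :: "nat \<Rightarrow> (nat \<Rightarrow> real^'n) \<Rightarrow> bool" where
  "on_sphere N x \<longleftrightarrow> (\<forall>i<N. x i \<in> sphere 0 1)"

text \<open>Normalized surface measure sigma_d on the unit sphere: the push-forward of the
  normalized Lebesgue measure on the unit ball under radial projection x / |x|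
  (the cone measure, which is the rotation-invariant probability measure on the sphere).\<close>

definition sphere_measure :: "(real^'n) measure" where
  "sphere_measure = distr (uniform_measure lborel (ball 0 1)) borel (\<lambda>x. x /\<^sub>R norm x)"

definition poly_fun_deg_le :: "nat \<Rightarrow> (real^'n \<Rightarrow> real) \<Rightarrow> bool" where
  "poly_fun_deg_le n p \<longleftrightarrow>
     (\<exists>c :: ('n \<Rightarrow> nat) \<Rightarrow> real.
        p = (\<lambda>x. \<Sum>\<alpha>\<in>{\<alpha>. sum \<alpha> UNIV \<le> n}. c \<alpha> * (\<Prod>i\<in>UNIV. (x $ i) ^ (\<alpha> i))))"

definition spherical_design :: "nat \<Rightarrow> (nat \<Rightarrow> real^'n) \<Rightarrow> nat \<Rightarrow> bool" where
  "spherical_design N x n \<longleftrightarrow> on_sphere N x \<and>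
     (\<forall>p. poly_fun_deg_le n p \<longrightarrow>
        (1 / real N) * (\<Sum>i<N. p (x i)) = integral\<^sup>L sphere_measure p)"

definition dot_products :: "nat \<Rightarrow> (nat \<Rightarrow> real^'n) \<Rightarrow> real set" where
  "dot_products N x = {x i \<bullet> x j | i j. i < N \<and> j < N \<and> i \<noteq> j}"

definition m_sharp :: "nat \<Rightarrow> (nat \<Rightarrow> real^'n) \<Rightarrow> nat \<Rightarrow> bool" where
  "m_sharp N x m \<longleftrightarrow> inj_on x {..<N} \<and> spherical_design N x (2 * m - 1)
      \<and> card (dot_products N x) = m"

definition strongly_m_sharp :: "nat \<Rightarrow> (nat \<Rightarrow> real^'n) \<Rightarrow> nat \<Rightarrow> bool" where
  "strongly_m_sharp N x m \<longleftrightarrow> m_sharp N x m \<and> spherical_design N x (2 * m)"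

definition sharp :: "nat \<Rightarrow> (nat \<Rightarrow> real^'n) \<Rightarrow> bool" where
  "sharp N x \<longleftrightarrow> (\<exists>m\<ge>1. m_sharp N x m)"

definition antipodal :: "nat \<Rightarrow> (nat \<Rightarrow> real^'n) \<Rightarrow> bool" where
  "antipodal N x \<longleftrightarrow> (\<forall>i<N. \<exists>j<N. x j = - x i)"

definition completely_monotone_on :: "real set \<Rightarrow> (real \<Rightarrow> real) \<Rightarrow> bool" where
  "completely_monotone_on I h \<longleftrightarrow>
     (\<exists>D :: nat \<Rightarrow> real \<Rightarrow> real.
        (\<forall>x\<in>I. D 0 x = h x) \<and>
        (\<forall>k. \<forall>x\<in>I. (D k has_real_derivative D (Suc k) x) (at x within I)) \<and>
        (\<forall>k. \<forall>x\<in>I. (-1) ^ k * D k x \<ge> 0))"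

definition strictly_completely_monotone_on :: "real set \<Rightarrow> (real \<Rightarrow> real) \<Rightarrow> bool" where
  "strictly_completely_monotone_on I h \<longleftrightarrow>
     (\<exists>D :: nat \<Rightarrow> real \<Rightarrow> real.
        (\<forall>x\<in>I. D 0 x = h x) \<and>
        (\<forall>k. \<forall>x\<in>I. (D k has_real_derivative D (Suc k) x) (at x within I)) \<and>
        (\<forall>k. \<forall>x\<in>I. (-1) ^ k * D k x \<ge> 0) \<and>
        (\<forall>k. \<forall>x\<in>interior I. (-1) ^ k * D k x > 0))"

definition p_f :: "(real \<Rightarrow> real) \<Rightarrow> nat \<Rightarrow> (nat \<Rightarrow> real^'n) \<Rightarrow> real^'n \<Rightarrow> real" where
  "p_f f N x y = (\<Sum>i<N. f ((norm (y - x i))\<^sup>2))"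

definition Q_f :: "(real \<Rightarrow> real) \<Rightarrow> nat \<Rightarrow> (nat \<Rightarrow> real^'n) \<Rightarrow> real" where
  "Q_f f N x = (SUP y\<in>sphere 0 1. p_f f N x y)"

end

theory Submission
  imports Defs
begin

text \<open>
  Write the potential as a function \<open>g\<close> of the dot product; all its derivatives of positive order
  are nonnegative on \<open>[-1, 1)\<close>. The maximum of the potential of \<open>\<omega>\<close> dominates its average over the
  points of \<open>\<omega>\<close>, which is \<open>1/N\<close> times the energy, the sum of \<open>g (x \<bullet> y)\<close> over all pairs. So it
  suffices that the sharp configuration minimizes the energy and that its potential is at most \<open>1/N\<close>
  times its energy. The latter holds because \<open>g\<close> lies below a polynomial interpolating it at the dot
  products and at \<open>1\<close>, whose degree does not exceed the strength of the design.

  For the former (the argument of Cohn and Kumar) one takes the polynomial below \<open>g\<close> interpolating it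
  doubly at the dot products \<open>t\<^sub>0 < t\<^sub>1 < \<dots>\<close>. Its Newton coefficients are nonnegative, and the Newton
  polynomials are products of polynomials \<open>F\<^sub>k = (t - t\<^sub>0) \<dots> (t - t\<^bsub>k-1\<^esub>)\<close>. Each \<open>F\<^sub>k\<close> is a nonnegative
  combination of the orthogonal polynomials of the distribution of dot products of the sharp
  configuration, as one sees by removing the largest node and passing to kernel polynomials; these
  orthogonal polynomials are positive definite by the design property. In the case of equality all
  Newton terms vanish, which forces the moments of both configurations to agree.\<close>

section \<open>Rotation invariance of the surface measure\<close>

text \<open>A design of strength \<open>2 * m - 1\<close> controls a product of two zonal
  polynomials only up to that total degree. No theory of Gegenbauer polynomials enters: sums over
  the design act as a convolution, and degrees \<open>m\<close> and \<open>m - 1\<close> just fit,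
  which suffices because a Newton polynomial with doubled nodes splits into two factors of degree at
  most \<open>m\<close>. For the majorant, doubling all dot products and adding the node 1 takes
  degree \<open>2 * m\<close>, hence strong sharpness. In the antipodal case \<open>-1\<close> is a
  dot product and an endpoint of the interval, so a simple node is enough there and degree
  \<open>2 * m - 1\<close> remains. Three boundary effects shape the details. \<open>f\<close> is
  merely continuous at 0, so at dot product 1 the Newton remainder is replaced by a limit. Only
  \<open>f + c\<close> has a sign, so the zeroth Newton coefficient has none; constants, however,
  have the same energy on all configurations. Strictness is assumed only in the interior, so a
  coefficient formed from the node \<open>-1\<close> alone may vanish.\<close>

lemma emeasure_lborel_le_orthogonal_image:
  fixes T :: "real^'n \<Rightarrow> real^'n"
  assumes T: "orthogonal_transformation T" and U: "open U"
  shows "emeasure lborel U \<le> emeasure lborel (T ` U)"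
proof -
  \<comment> \<open>Vitali covering: up to a null set, \<open>U\<close> is a countable disjoint
    union of balls inside it, and \<open>T\<close> sends a ball to a ball of the same radius. The
    image of the leftover null set is not controlled, so only an inequality results; the inverse of
    \<open>T\<close> supplies the other one.\<close>
  let ?K = "{(a, r). 0 < r \<and> ball a r \<subseteq> U}"
  have cover: "\<exists>i. i \<in> ?K \<and> x \<in> ball (fst i) (snd i) \<and> snd i < e" if xU: "x \<in> U" and "0 < e" for x and e :: real
  proof -
    obtain r where "r > 0" "ball x r \<subseteq> U"
      by (rule openE[OF U xU])
    then have "ball x (min r (e/2)) \<subseteq> U"
      using subset_ball[of "min r (e/2)" r x] by force
    with \<open>r > 0\<close> \<open>e > 0\<close> show ?thesis
      by (intro exI[of _ "(x, min r (e/2))"]) auto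
  qed
  obtain C where C: "countable C" "C \<subseteq> ?K"
     "pairwise (\<lambda>i j. disjnt (ball (fst i) (snd i)) (ball (fst j) (snd j))) C"
     and negl: "negligible (U - (\<Union>i\<in>C. ball (fst i) (snd i)))"
    by (rule Vitali_covering_theorem_balls[of U ?K fst snd, OF cover])
  let ?B = "\<lambda>i. ball (fst i) (snd i) :: (real^'n) set"
  have B: "0 < snd i" "?B i \<subseteq> U" if "i \<in> C" for i
    using subsetD[OF C(2) that] by (simp_all add: case_prod_beta)
  have disj: "disjoint_family_on ?B C"
    using C(3) unfolding disjoint_family_on_def pairwise_def disjnt_def by blast
  have img: "T ` ?B i = ball (T (fst i)) (snd i)" for i
    using image_orthogonal_transformation_ball[OF T] by simp
  have disj': "disjoint_family_on (\<lambda>i. T ` ?B i) C"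
    using disj orthogonal_transformation_inj[OF T]
    unfolding disjoint_family_on_def by (metis image_Int image_empty)
  have null: "(U - (\<Union>i\<in>C. ?B i)) \<in> null_sets lborel"
  proof -
    have "U - (\<Union>i\<in>C. ?B i) \<in> sets borel"
      using U C(1) by (intro sets.Diff sets.countable_UN') auto
    then show ?thesis
      using negl by (simp add: negligible_iff_null_sets null_sets_completion_iff)
  qed
  have "emeasure lborel U = emeasure lborel ((\<Union>i\<in>C. ?B i) \<union> (U - (\<Union>i\<in>C. ?B i)))"
    using B(2) by (intro arg_cong[where f = "emeasure lborel"]) blast
  also have "\<dots> = emeasure lborel (\<Union>i\<in>C. ?B i)"
    using null C(1) by (intro emeasure_Un_null_set) auto
  also have "\<dots> = (\<integral>\<^sup>+ i. emeasure lborel (?B i) \<partial>count_space C)"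
    using C(1) disj by (intro emeasure_UN_countable) auto
  also have "\<dots> = (\<integral>\<^sup>+ i. emeasure lborel (T ` ?B i) \<partial>count_space C)"
    using B(1) by (intro nn_integral_cong) (simp add: img emeasure_ball less_imp_le)
  also have "\<dots> = emeasure lborel (\<Union>i\<in>C. T ` ?B i)"
    using C(1) disj' by (intro emeasure_UN_countable[symmetric]) (auto simp: img)
  also have "\<dots> \<le> emeasure lborel (T ` U)"
  proof (rule emeasure_mono)
    show "(\<Union>i\<in>C. T ` ?B i) \<subseteq> T ` U" using B(2) by blast
    have "open (T ` U)"
      using U T by (metis open_surjective_linear_image orthogonal_transformation_linear
          orthogonal_transformation_surj)
    then show "T ` U \<in> sets lborel" by simp
  qed
  finally show ?thesis .
qed

lemma distr_lborel_orthogonal: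
  fixes T :: "real^'n \<Rightarrow> real^'n"
  assumes T: "orthogonal_transformation T"
  shows "distr lborel borel T = lborel"
proof (rule lborel_eqI[symmetric])
  fix l u :: "real^'n"
  assume lu: "\<And>b. b \<in> Basis \<Longrightarrow> l \<bullet> b \<le> u \<bullet> b"
  have contT: "continuous_on UNIV T"
    by (intro linear_continuous_on) (use T orthogonal_transformation_linear linear_conv_bounded_linear in blast)
  have meas: "T \<in> measurable lborel borel"
    using contT by (simp add: borel_measurable_continuous_onI)
  have opn: "open (T -` box l u)"
    using contT open_vimage[of "box l u" T] by (simp add: open_box)
  have eq: "T ` (T -` box l u) = box l u"
    using orthogonal_transformation_surj[OF T] by (simp add: surj_image_vimage_eq)
  have inv: "orthogonal_transformation (inv T)"
    using T by (simp add: orthogonal_transformation_inv)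
  have eq2: "inv T ` box l u = T -` box l u"
    using orthogonal_transformation_bij[OF T] by (simp add: bij_vimage_eq_inv_image)
  have "emeasure lborel (T -` box l u) = emeasure lborel (box l u)"
    using emeasure_lborel_le_orthogonal_image[OF T opn]
      emeasure_lborel_le_orthogonal_image[OF inv, of "box l u"]
    unfolding eq eq2 by (simp add: antisym open_box)
  then show "emeasure (distr lborel borel T) (box l u) = ennreal (\<Prod>b\<in>Basis. (u - l) \<bullet> b)"
    using meas lu by (simp add: emeasure_distr emeasure_lborel_box)
qed simp

text \<open>\<open>T\<close> preserves Lebesgue measure and the ball and commutes with radial
  projection, so the cone measure inherits the invariance.\<close>

lemma sphere_measure_orthogonal:
  fixes T :: "real^'n \<Rightarrow> real^'n"
  assumes T: "orthogonal_transformation T"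
  shows "distr sphere_measure borel T = sphere_measure"
proof -
  let ?U = "uniform_measure lborel (ball 0 1) :: (real^'n) measure"
  let ?P = "\<lambda>x :: real^'n. x /\<^sub>R norm x"
  have linT: "linear T" and normT: "norm (T x) = norm x" for x
    using T orthogonal_transformation_linear orthogonal_transformation_norm by blast+
  have T_meas [measurable]: "T \<in> measurable borel borel"
    using linT by (intro borel_measurable_continuous_onI linear_continuous_on)
       (simp add: linear_conv_bounded_linear)
  have P_meas [measurable]: "?P \<in> measurable borel borel" by measurable
  have comm: "T (?P x) = ?P (T x)" for x
    using linT by (simp add: linear_scale normT)
  have uni: "distr ?U borel T = ?U"
  proof (rule measure_eqI)
    fix A assume A: "A \<in> sets (distr ?U borel T)"
    then have A': "A \<in> sets borel" by simp
    have pre: "T -` A \<in> sets borel"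
      using measurable_sets[OF T_meas A'] by simp
    have "ball 0 1 \<inter> T -` A = T -` (ball 0 1 \<inter> A)"
      by (auto simp: normT)
    moreover have "emeasure lborel (T -` (ball 0 1 \<inter> A)) = emeasure (distr lborel borel T) (ball 0 1 \<inter> A)"
      using A' by (subst emeasure_distr) auto
    ultimately have "emeasure lborel (ball 0 1 \<inter> T -` A) = emeasure lborel (ball 0 1 \<inter> A)"
      by (simp add: distr_lborel_orthogonal[OF T])
    then show "emeasure (distr ?U borel T) A = emeasure ?U A"
      using A' pre by (subst emeasure_distr) auto
  qed simp
  have "distr sphere_measure borel T = distr ?U borel (T \<circ> ?P)"
    unfolding sphere_measure_def by (subst distr_distr) auto
  also have "T \<circ> ?P = ?P \<circ> T"
    using comm by (auto simp: fun_eq_iff)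
  also have "distr ?U borel (?P \<circ> T) = distr (distr ?U borel T) borel ?P"
    by (subst distr_distr) auto
  finally show ?thesis
    by (simp add: uni sphere_measure_def)
qed

lemma integral_sphere_measure_orthogonal:
  fixes T :: "real^'n \<Rightarrow> real^'n" and p :: "real^'n \<Rightarrow> real"
  assumes T: "orthogonal_transformation T" and p: "p \<in> borel_measurable borel"
  shows "integral\<^sup>L sphere_measure (\<lambda>x. p (T x)) = integral\<^sup>L sphere_measure p"
proof -
  have "T \<in> measurable sphere_measure borel"
    using T unfolding sphere_measure_def measurable_distr_eq1
    by (intro borel_measurable_continuous_onI linear_continuous_on)
       (metis linear_conv_bounded_linear orthogonal_transformation_linear)
  then have "integral\<^sup>L (distr sphere_measure borel T) p = integral\<^sup>L sphere_measure (\<lambda>x. p (T x))"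
    using p by (rule integral_distr)
  then show ?thesis
    by (simp add: sphere_measure_orthogonal[OF T])
qed

text \<open>After \<open>R\<close> has moved \<open>x\<close> to \<open>x'\<close>, the reflection
  along \<open>R y - y'\<close> sends \<open>R y\<close> to \<open>y'\<close>, since their norms
  agree, and fixes \<open>x'\<close>, since their inner products with \<open>x'\<close>
  agree.\<close>

lemma orthogonal_transformation_exists_2:
  fixes x y x' y' :: "real^'n"
  assumes "norm x = norm x'" "norm y = norm y'" "x \<bullet> y = x' \<bullet> y'"
  obtains T where "orthogonal_transformation T" "T x = x'" "T y = y'"
proof -
  obtain R where R: "orthogonal_transformation R" "R x = x'"
    using orthogonal_transformation_exists[OF assms(1)] .
  define v where "v = R y - y'"
  have Ry: "R y \<bullet> R y = y' \<bullet> y'" "R y \<bullet> x' = y' \<bullet> x'"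
    using R assms by (metis dot_square_norm orthogonal_transformation_norm)
      (metis R assms(3) inner_commute orthogonal_transformation_def)
  define H where "H = (\<lambda>z. z - (2 / (v \<bullet> v) * (z \<bullet> v)) *\<^sub>R v)"
  have "orthogonal_transformation H"
    unfolding orthogonal_transformation_def
  proof (intro conjI allI)
    show "linear H"
      unfolding H_def
      by (rule linearI) (simp_all only: inner_add_left inner_scaleR_left distrib_left scaleR_add_left
          scaleR_diff_right scaleR_scaleR, simp_all add: mult_ac)
    show "H a \<bullet> H b = a \<bullet> b" for a b
    proof (cases "v = 0")
      case False
      define c where "c = 2 / (v \<bullet> v)"
      have c: "c * (v \<bullet> v) = 2" using False by (simp add: c_def)
      have "H a \<bullet> H b = a \<bullet> b - 2 * c * (a \<bullet> v) * (b \<bullet> v) + c * (a \<bullet> v) * (b \<bullet> v) * (c * (v \<bullet> v))"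
        unfolding H_def c_def[symmetric]
        by (simp only: inner_diff_left inner_diff_right inner_scaleR_left inner_scaleR_right
            inner_commute[of v b]) (simp add: algebra_simps)
      then show ?thesis by (simp add: c)
    qed (simp add: H_def)
  qed
  moreover have "H x' = x'"
    using Ry(2) by (simp add: H_def v_def inner_diff_right inner_commute)
  moreover have "H (R y) = y'"
  proof (cases "v = 0")
    case True then show ?thesis by (simp add: H_def v_def)
  next
    case False
    have "v \<bullet> v = 2 * (R y \<bullet> v)"
      using Ry(1) by (simp add: v_def inner_diff_left inner_diff_right inner_commute)
    moreover have "v \<bullet> v \<noteq> 0" using False by simp
    ultimately have "2 / (v \<bullet> v) * (R y \<bullet> v) = 1"
      by (metis mult_2 times_divide_eq_left divide_self)
    then have "H (R y) = R y - v" unfolding H_def by (simp only: scaleR_one)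
    then show ?thesis by (simp add: v_def)
  qed
  ultimately show thesis
    using R that[of "H \<circ> R"] by (auto intro: orthogonal_transformation_compose)
qed

section \<open>Zonal polynomials and positive definite kernels\<close>

text \<open>Monomials are indexed by words instead of exponent vectors: powers of an inner product
  then expand without multinomial coefficients.\<close>

definition mono_fun :: "'n list \<Rightarrow> real^'n \<Rightarrow> real" where
  "mono_fun l x = (\<Prod>i\<leftarrow>l. x $ i)"

lemma mono_fun_simps [simp]:
  "mono_fun [] x = 1" "mono_fun (i # l) x = x $ i * mono_fun l x"
  "mono_fun (l @ l') x = mono_fun l x * mono_fun l' x"
  by (simp_all add: mono_fun_def)

lemma finite_lists_length [simp]: "finite {l :: 'n::finite list. length l = k}"
  using finite_lists_length_eq[of "UNIV :: 'n set" k] by simp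

lemma inner_power_mono_fun:
  fixes x y :: "real^'n"
  shows "(x \<bullet> y) ^ k = (\<Sum>l | length l = k. mono_fun l x * mono_fun l y)"
proof (induction k)
  case (Suc k)
  have "{l :: 'n list. length l = Suc k} = (\<lambda>(i, l). i # l) ` (UNIV \<times> {l. length l = k})"
    by (auto simp: length_Suc_conv image_iff)
  then have "(\<Sum>l | length l = Suc k. mono_fun l x * mono_fun l y) =
      (\<Sum>(i, l)\<in>UNIV \<times> {l. length l = k}. mono_fun (i # l) x * mono_fun (i # l) y)"
    by (simp add: sum.reindex inj_on_def case_prod_beta)
  also have "\<dots> = (\<Sum>i\<in>UNIV. \<Sum>l | length l = k. mono_fun (i # l) x * mono_fun (i # l) y)"
    by (rule sum.cartesian_product[symmetric])
  finally have "(\<Sum>l | length l = Suc k. mono_fun l x * mono_fun l y) =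
      (\<Sum>i\<in>UNIV. \<Sum>l | length l = k. mono_fun (i # l) x * mono_fun (i # l) y)" .
  then have "(\<Sum>l | length l = Suc k. mono_fun l x * mono_fun l y) =
      (\<Sum>i\<in>UNIV. x $ i * y $ i) * (\<Sum>l | length l = k. mono_fun l x * mono_fun l y)"
    by (simp add: sum_product mult_ac)
  moreover have "x \<bullet> y = (\<Sum>i\<in>UNIV. x $ i * y $ i)" by (simp add: inner_vec_def)
  ultimately show ?case by (simp only: power_Suc Suc.IH[symmetric])
qed (simp add: mono_fun_def)

lemma mono_fun_count_list:
  fixes x :: "real^'n"
  shows "mono_fun l x = (\<Prod>i\<in>UNIV. (x $ i) ^ count_list l i)"
proof (induction l)
  case (Cons a l)
  have "(\<Prod>i\<in>UNIV. (x $ i) ^ count_list (a # l) i) =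
      (\<Prod>i\<in>UNIV. (if i = a then x $ i else 1) * (x $ i) ^ count_list l i)"
    by (intro prod.cong) auto
  then show ?case by (simp add: prod.distrib Cons)
qed simp

lemma mono_fun_of_exponents:
  fixes \<alpha> :: "'n::finite \<Rightarrow> nat"
  obtains l where "length l = sum \<alpha> UNIV" "\<And>x :: real^'n. mono_fun l x = (\<Prod>i\<in>UNIV. (x $ i) ^ \<alpha> i)"
proof -
  obtain l where l: "mset l = (\<Sum>i\<in>UNIV. replicate_mset (\<alpha> i) i)"
    using ex_mset by blast
  have "count_list l j = \<alpha> j" for j
  proof -
    have "count_list l j = count (mset l) j" by (simp add: count_mset)
    also have "\<dots> = (\<Sum>i\<in>UNIV. if i = j then \<alpha> i else 0)"
      unfolding l by (simp add: count_sum)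
    finally show ?thesis by simp
  qed
  then have c: "count_list l = \<alpha>" by blast
  have "length l = sum (count_list l) UNIV"
    by (rule sum_count_set[symmetric]) auto
  then show thesis
    using that[of l] by (simp add: mono_fun_count_list c)
qed

lemma finite_exponents: "finite {\<alpha> :: 'n::finite \<Rightarrow> nat. sum \<alpha> UNIV \<le> n}"
proof (rule finite_subset)
  show "{\<alpha> :: 'n \<Rightarrow> nat. sum \<alpha> UNIV \<le> n} \<subseteq> PiE UNIV (\<lambda>_. {..n})"
  proof
    fix \<alpha> :: "'n \<Rightarrow> nat" assume "\<alpha> \<in> {\<alpha>. sum \<alpha> UNIV \<le> n}"
    then have "\<alpha> i \<le> n" for i
      using member_le_sum[of i UNIV \<alpha>] by simp
    then show "\<alpha> \<in> PiE UNIV (\<lambda>_. {..n})" by (simp add: PiE_UNIV_domain)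
  qed
qed (simp add: finite_PiE)

lemma poly_fun_mono_fun:
  assumes "length l \<le> n"
  shows "poly_fun_deg_le n (mono_fun l :: real^'n \<Rightarrow> real)"
proof -
  let ?A = "{\<alpha> :: 'n \<Rightarrow> nat. sum \<alpha> UNIV \<le> n}"
  have mem: "count_list l \<in> ?A"
    using assms sum_count_set[of l UNIV] by simp
  have "mono_fun l = (\<lambda>x :: real^'n. \<Sum>\<alpha>\<in>?A.
      (if \<alpha> = count_list l then 1 else 0) * (\<Prod>i\<in>UNIV. (x $ i) ^ \<alpha> i))"
  proof
    fix x :: "real^'n"
    have "(\<Sum>\<alpha>\<in>?A. (if \<alpha> = count_list l then 1 else 0) * (\<Prod>i\<in>UNIV. (x $ i) ^ \<alpha> i)) =
      (\<Sum>\<alpha>\<in>{count_list l}. (if \<alpha> = count_list l then 1 else 0) * (\<Prod>i\<in>UNIV. (x $ i) ^ \<alpha> i))"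
      using mem by (intro sum.mono_neutral_right finite_exponents) auto
    then show "mono_fun l x = (\<Sum>\<alpha>\<in>?A. (if \<alpha> = count_list l then 1 else 0) * (\<Prod>i\<in>UNIV. (x $ i) ^ \<alpha> i))"
      by (simp add: mono_fun_count_list)
  qed
  then show ?thesis unfolding poly_fun_deg_le_def
    by (intro exI[of _ "\<lambda>\<alpha>. if \<alpha> = count_list l then 1 else 0"])
qed

lemma poly_fun_add:
  assumes "poly_fun_deg_le n p" "poly_fun_deg_le n q"
  shows "poly_fun_deg_le n (\<lambda>x. p x + q x)"
proof -
  obtain c d where "p = (\<lambda>x. \<Sum>\<alpha>\<in>{\<alpha>. sum \<alpha> UNIV \<le> n}. c \<alpha> * (\<Prod>i\<in>UNIV. (x $ i) ^ \<alpha> i))"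
    "q = (\<lambda>x. \<Sum>\<alpha>\<in>{\<alpha>. sum \<alpha> UNIV \<le> n}. d \<alpha> * (\<Prod>i\<in>UNIV. (x $ i) ^ \<alpha> i))"
    using assms unfolding poly_fun_deg_le_def by blast
  then show ?thesis unfolding poly_fun_deg_le_def
    by (intro exI[of _ "\<lambda>\<alpha>. c \<alpha> + d \<alpha>"]) (simp add: sum.distrib distrib_right)
qed

lemma poly_fun_scale:
  assumes "poly_fun_deg_le n p"
  shows "poly_fun_deg_le n (\<lambda>x. a * p x)"
proof -
  obtain c where "p = (\<lambda>x. \<Sum>\<alpha>\<in>{\<alpha>. sum \<alpha> UNIV \<le> n}. c \<alpha> * (\<Prod>i\<in>UNIV. (x $ i) ^ \<alpha> i))"
    using assms unfolding poly_fun_deg_le_def by blast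
  then show ?thesis unfolding poly_fun_deg_le_def
    by (intro exI[of _ "\<lambda>\<alpha>. a * c \<alpha>"]) (simp add: sum_distrib_left mult.assoc)
qed

lemma poly_fun_zero: "poly_fun_deg_le n (\<lambda>x. 0)"
  unfolding poly_fun_deg_le_def by (intro exI[of _ "\<lambda>\<alpha>. 0"]) simp

lemma poly_fun_sum:
  assumes "\<And>i. i \<in> I \<Longrightarrow> poly_fun_deg_le n (f i)"
  shows "poly_fun_deg_le n (\<lambda>x. \<Sum>i\<in>I. f i x)"
  using assms
  by (induction I rule: infinite_finite_induct) (simp_all add: poly_fun_zero poly_fun_add)

lemma poly_fun_inner_powers:
  fixes x z :: "real^'n"
  assumes "a + c \<le> n"
  shows "poly_fun_deg_le n (\<lambda>y. (x \<bullet> y) ^ a * (z \<bullet> y) ^ c)"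
proof -
  have "(\<lambda>y. (x \<bullet> y) ^ a * (z \<bullet> y) ^ c) = (\<lambda>y. \<Sum>l | length l = a. \<Sum>l' | length l' = c.
      (mono_fun l x * mono_fun l' z) * mono_fun (l @ l') y)"
    by (simp add: inner_power_mono_fun sum_product mult_ac)
  then show ?thesis
    using assms by (simp only:) (intro poly_fun_sum poly_fun_scale poly_fun_mono_fun, auto)
qed

lemma poly_fun_zonal:
  fixes x z :: "real^'n"
  assumes "degree p + degree r \<le> n"
  shows "poly_fun_deg_le n (\<lambda>y. poly p (x \<bullet> y) * poly r (z \<bullet> y))"
proof -
  have "(\<lambda>y. poly p (x \<bullet> y) * poly r (z \<bullet> y)) = (\<lambda>y. \<Sum>i\<le>degree p. \<Sum>j\<le>degree r.
      (coeff p i * coeff r j) * ((x \<bullet> y) ^ i * (z \<bullet> y) ^ j))"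
    by (simp add: poly_altdef sum_product mult_ac)
  then show ?thesis
    using assms by (simp only:) (intro poly_fun_sum poly_fun_scale poly_fun_inner_powers, auto)
qed

text \<open>Within the strength of the design the sum is \<open>N\<close> times an integral over the
  sphere, which does not change when \<open>x\<close> and \<open>z\<close> are rotated together,
  although the points \<open>b j\<close> stay fixed.\<close>

lemma design_sum_orthogonal:
  fixes b :: "nat \<Rightarrow> real^'n"
  assumes design: "spherical_design N b M" and deg: "degree p + degree r \<le> M"
    and T: "orthogonal_transformation T"
  shows "(\<Sum>j<N. poly p (x \<bullet> b j) * poly r (z \<bullet> b j)) =
    (\<Sum>j<N. poly p (T x \<bullet> b j) * poly r (T z \<bullet> b j))"
proof (cases "N = 0")
  case False
  define \<phi> where "\<phi> x z y = poly p (x \<bullet> y) * poly r (z \<bullet> y)" for x z y :: "real^'n"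
  have avg: "(1 / real N) * (\<Sum>j<N. \<phi> x z (b j)) = integral\<^sup>L sphere_measure (\<phi> x z)" for x z
    using design poly_fun_zonal[OF deg, of x z] unfolding spherical_design_def \<phi>_def by blast
  have "\<phi> (T x) (T z) \<in> borel_measurable borel"
    unfolding \<phi>_def by (intro borel_measurable_continuous_onI continuous_intros)
  then have "integral\<^sup>L sphere_measure (\<lambda>y. \<phi> (T x) (T z) (T y)) = integral\<^sup>L sphere_measure (\<phi> (T x) (T z))"
    by (rule integral_sphere_measure_orthogonal[OF T])
  moreover have "(\<lambda>y. \<phi> (T x) (T z) (T y)) = \<phi> x z"
    using T by (simp add: \<phi>_def orthogonal_transformation_def fun_eq_iff)
  ultimately have "(1 / real N) * (\<Sum>j<N. \<phi> x z (b j)) = (1 / real N) * (\<Sum>j<N. \<phi> (T x) (T z) (b j))"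
    by (simp only: avg)
  then show ?thesis using False by (simp add: \<phi>_def)
qed simp

lemma design_sum_const:
  fixes b :: "nat \<Rightarrow> real^'n"
  assumes design: "spherical_design N b M" and deg: "degree p \<le> M" and "norm x = norm z"
  shows "(\<Sum>j<N. poly p (x \<bullet> b j)) = (\<Sum>j<N. poly p (z \<bullet> b j))"
proof -
  obtain T where T: "orthogonal_transformation T" "T x = z"
    using orthogonal_transformation_exists[OF assms(3)] .
  then show ?thesis
    using design_sum_orthogonal[OF design _ T(1), of p 1 x 0] deg by simp
qed

text \<open>For \<open>s^2 = 1 - u^2\<close> the function \<open>(u A + s B)^k + (u A - s B)^k\<close>, being even in \<open>s\<close>, is a
  polynomial in \<open>u\<close>; the recursion is that of power sums of the two numbers.\<close>

fun even_part :: "real \<Rightarrow> real \<Rightarrow> nat \<Rightarrow> real poly" where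
  "even_part A B 0 = [:2:]"
| "even_part A B (Suc 0) = [:0, 2 * A:]"
| "even_part A B (Suc (Suc k)) =
     [:0, 2 * A:] * even_part A B (Suc k) - [:- B\<^sup>2, 0, A\<^sup>2 + B\<^sup>2:] * even_part A B k"

lemma degree_even_part: "degree (even_part A B k) \<le> k"
proof (induction k rule: induct_nat_012)
  case (ge2 k)
  have "degree ([:0, 2 * A:] * even_part A B (Suc k)) \<le> 1 + Suc k"
    using ge2 by (intro order_trans[OF degree_mult_le] add_mono) auto
  moreover have "degree ([:- B\<^sup>2, 0, A\<^sup>2 + B\<^sup>2:] * even_part A B k) \<le> 2 + k"
    using ge2 by (intro order_trans[OF degree_mult_le] add_mono) auto
  ultimately show ?case
    unfolding even_part.simps by (intro degree_diff_le) simp_all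
qed auto

lemma poly_even_part:
  assumes "s\<^sup>2 = 1 - u\<^sup>2"
  shows "poly (even_part A B k) u = (u * A + s * B) ^ k + (u * A - s * B) ^ k"
proof (induction k rule: induct_nat_012)
  case (ge2 k)
  have rec: "a ^ Suc (Suc k) + c ^ Suc (Suc k) = (a + c) * (a ^ Suc k + c ^ Suc k) - (a * c) * (a ^ k + c ^ k)"
    for a c :: real by (simp add: algebra_simps)
  have "(u * A + s * B) * (u * A - s * B) = u\<^sup>2 * A\<^sup>2 - s\<^sup>2 * B\<^sup>2"
    by (simp add: power2_eq_square algebra_simps)
  also have "\<dots> = poly [:- B\<^sup>2, 0, A\<^sup>2 + B\<^sup>2:] u"
    unfolding assms by (simp add: power2_eq_square algebra_simps)
  finally have ac: "(u * A + s * B) * (u * A - s * B) = poly [:- B\<^sup>2, 0, A\<^sup>2 + B\<^sup>2:] u" .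
  have "(u * A + s * B) + (u * A - s * B) = poly [:0, 2 * A:] u" by simp
  then show ?case
    unfolding rec ac even_part.simps poly_diff poly_mult ge2 by simp
qed (simp_all add: algebra_simps)

text \<open>A convolution of zonal functions with the design in place of the sphere: by rotation the
  sum depends on \<open>x \<bullet> z\<close> only. The degree bound by \<open>r\<close> alone is
  what later keeps results in low degree.\<close>

lemma design_convolution:
  fixes b :: "nat \<Rightarrow> real^'n"
  assumes card: "2 \<le> CARD('n)" and design: "spherical_design N b M"
    and deg: "degree p + degree r \<le> M"
  obtains G where "degree G \<le> degree r"
    "\<And>x z. norm x = 1 \<Longrightarrow> norm z = 1 \<Longrightarrow>
      (\<Sum>j<N. poly p (x \<bullet> b j) * poly r (z \<bullet> b j)) = poly G (x \<bullet> z)"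
proof -
  obtain i j :: 'n where ij: "i \<noteq> j"
    using card by (metis card_2_iff' card_le_Suc0_iff_eq finite not_less_eq_eq numeral_2_eq_2 UNIV_I)
  define e1 e2 :: "real^'n" where "e1 = axis i 1" and "e2 = axis j 1"
  have e: "e1 \<bullet> e1 = 1" "e2 \<bullet> e2 = 1" "e1 \<bullet> e2 = 0"
    using ij by (auto simp: e1_def e2_def inner_axis_axis)
  define E where "E k = (\<Sum>d\<le>degree r. smult (coeff r d) (even_part (e1 \<bullet> b k) (e2 \<bullet> b k) d))" for k
  define G where "G = smult (1/2) (\<Sum>k<N. smult (poly p (e1 \<bullet> b k)) (E k))"
  have "degree (E k) \<le> degree r" for k
    unfolding E_def
    by (intro degree_sum_le order_trans[OF degree_smult_le] order_trans[OF degree_even_part]) auto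
  then have "degree G \<le> degree r"
    unfolding G_def by (intro degree_sum_le order_trans[OF degree_smult_le]) auto
  moreover have "(\<Sum>j<N. poly p (x \<bullet> b j) * poly r (z \<bullet> b j)) = poly G (x \<bullet> z)"
    if x: "norm x = 1" and z: "norm z = 1" for x z
  proof -
    define u where "u = x \<bullet> z"
    define s where "s = sqrt (1 - u\<^sup>2)"
    have "\<bar>u\<bar> \<le> 1" using Cauchy_Schwarz_ineq2[of x z] x z by (simp add: u_def)
    then have s2: "s\<^sup>2 = 1 - u\<^sup>2" by (simp add: s_def abs_square_le_1)
    \<comment> \<open>Rotate \<open>x\<close> to \<open>e1\<close> and \<open>z\<close> into the
      plane of \<open>e1\<close> and \<open>e2\<close>. Both \<open>s\<close> and \<open>- s\<close>
      are admissible for \<open>s'\<close>; averaging the two removes the square root.\<close>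
    have *: "(\<Sum>j<N. poly p (x \<bullet> b j) * poly r (z \<bullet> b j)) =
        (\<Sum>j<N. poly p (e1 \<bullet> b j) * poly r (u * (e1 \<bullet> b j) + s' * (e2 \<bullet> b j)))"
      if s': "s'\<^sup>2 = 1 - u\<^sup>2" for s'
    proof -
      let ?z = "u *\<^sub>R e1 + s' *\<^sub>R e2"
      have "?z \<bullet> ?z = u\<^sup>2 + s'\<^sup>2"
        using e by (simp add: inner_add_left inner_add_right inner_commute[of e2 e1] power2_eq_square)
      then have "norm ?z = norm z" using s' z by (simp add: norm_eq_sqrt_inner)
      moreover have "norm x = norm e1" using x e(1) by (simp add: norm_eq_sqrt_inner)
      moreover have "x \<bullet> z = e1 \<bullet> ?z" using e by (simp add: inner_add_right u_def)
      ultimately obtain T where "orthogonal_transformation T" "T x = e1" "T z = ?z"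
        using orthogonal_transformation_exists_2 by metis
      then show ?thesis
        using design_sum_orthogonal[OF design deg, of T x z] by (simp add: inner_add_left)
    qed
    have E: "poly (E k) u = poly r (u * (e1 \<bullet> b k) + s * (e2 \<bullet> b k)) + poly r (u * (e1 \<bullet> b k) - s * (e2 \<bullet> b k))" for k
      unfolding E_def by (simp add: poly_sum poly_even_part[OF s2] poly_altdef[of r] sum.distrib distrib_left)
    have "2 * (\<Sum>j<N. poly p (x \<bullet> b j) * poly r (z \<bullet> b j)) = (\<Sum>k<N. poly p (e1 \<bullet> b k) * poly (E k) u)"
      using *[OF s2] *[of "- s"] s2 unfolding E by (simp add: distrib_left sum.distrib)
    then show ?thesis unfolding G_def u_def[symmetric] by (simp add: poly_sum)
  qed
  ultimately show thesis by (rule that)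
qed

text \<open>Finite sums of rank one kernels, rather than kernels with nonnegative quadratic forms:
  closure under products and nonnegativity of signed double sums become inductions, without matrix
  theory.\<close>

inductive pd_kernel :: "('a \<Rightarrow> 'a \<Rightarrow> real) \<Rightarrow> bool" where
  pd_kernel_zero: "pd_kernel (\<lambda>x y. 0)"
| pd_kernel_rank1: "pd_kernel K \<Longrightarrow> pd_kernel (\<lambda>x y. K x y + \<phi> x * \<phi> y)"

lemma pd_kernel_add:
  assumes "pd_kernel L" "pd_kernel K"
  shows "pd_kernel (\<lambda>x y. K x y + L x y)"
  using assms
proof (induction rule: pd_kernel.induct)
  case (pd_kernel_rank1 L \<phi>)
  then have "pd_kernel (\<lambda>x y. (K x y + L x y) + \<phi> x * \<phi> y)"
    by (intro pd_kernel.pd_kernel_rank1) auto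
  then show ?case by (simp add: add.assoc)
qed simp

lemma pd_kernel_mult_rank1:
  assumes "pd_kernel K"
  shows "pd_kernel (\<lambda>x y. K x y * (\<phi> x * \<phi> y))"
  using assms
proof (induction rule: pd_kernel.induct)
  case (pd_kernel_rank1 K \<psi>)
  then have "pd_kernel (\<lambda>x y. K x y * (\<phi> x * \<phi> y) + (\<psi> x * \<phi> x) * (\<psi> y * \<phi> y))"
    by (intro pd_kernel.pd_kernel_rank1)
  then show ?case by (simp add: algebra_simps)
qed (simp add: pd_kernel_zero)

lemma pd_kernel_mult:
  assumes "pd_kernel L" "pd_kernel K"
  shows "pd_kernel (\<lambda>x y. K x y * L x y)"
  using assms
proof (induction rule: pd_kernel.induct)
  case (pd_kernel_rank1 L \<phi>)
  then have "pd_kernel (\<lambda>x y. K x y * L x y + K x y * (\<phi> x * \<phi> y))"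
    by (intro pd_kernel_add pd_kernel_mult_rank1) auto
  then show ?case by (simp add: distrib_left)
qed (simp add: pd_kernel_zero)

lemma pd_kernel_const:
  assumes "0 \<le> c"
  shows "pd_kernel (\<lambda>x y. c)"
  using pd_kernel_rank1[OF pd_kernel_zero, of "\<lambda>_. sqrt c"] assms by simp

lemma pd_kernel_sum:
  "finite I \<Longrightarrow> (\<And>i. i \<in> I \<Longrightarrow> pd_kernel (K i)) \<Longrightarrow> pd_kernel (\<lambda>x y. \<Sum>i\<in>I. K i x y)"
  by (induction I rule: finite_induct) (auto intro: pd_kernel_zero pd_kernel_add)

lemma pd_kernel_inner: "pd_kernel (\<lambda>x y :: real^'n. x \<bullet> y)"
  unfolding inner_vec_def
  using pd_kernel_rank1[OF pd_kernel_zero] by (intro pd_kernel_sum) auto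

lemma pd_kernel_inner_power: "pd_kernel (\<lambda>x y :: real^'n. (x \<bullet> y) ^ k)"
  by (induction k) (auto intro: pd_kernel_const pd_kernel_mult pd_kernel_inner)

text \<open>The kernel obtained by testing against the signed measures
  \<open>\<delta>\<^sub>x - (\<Sum>k\<in>I. u k x \<delta>\<^bsub>b k\<^esub>)\<close> in both variables.\<close>

lemma pd_kernel_compress:
  assumes "pd_kernel K"
  shows "pd_kernel (\<lambda>x z. K x z - (\<Sum>k\<in>I. u k x * K (b k) z) - (\<Sum>l\<in>I. u l z * K x (b l))
    + (\<Sum>k\<in>I. \<Sum>l\<in>I. u k x * u l z * K (b k) (b l)))"
  using assms
proof (induction rule: pd_kernel.induct)
  case (pd_kernel_rank1 K \<phi>)
  define \<psi> where "\<psi> x = \<phi> x - (\<Sum>k\<in>I. u k x * \<phi> (b k))" for x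
  have "pd_kernel (\<lambda>x z. K x z - (\<Sum>k\<in>I. u k x * K (b k) z) - (\<Sum>l\<in>I. u l z * K x (b l))
    + (\<Sum>k\<in>I. \<Sum>l\<in>I. u k x * u l z * K (b k) (b l)) + \<psi> x * \<psi> z)"
    using pd_kernel_rank1.IH by (rule pd_kernel.pd_kernel_rank1)
  moreover have "\<psi> x * \<psi> z = \<phi> x * \<phi> z - (\<Sum>k\<in>I. u k x * (\<phi> (b k) * \<phi> z))
      - (\<Sum>l\<in>I. u l z * (\<phi> x * \<phi> (b l))) + (\<Sum>k\<in>I. \<Sum>l\<in>I. u k x * u l z * (\<phi> (b k) * \<phi> (b l)))" for x z
  proof -
    have "\<psi> x * \<psi> z = \<phi> x * \<phi> z - (\<Sum>k\<in>I. u k x * \<phi> (b k)) * \<phi> z - \<phi> x * (\<Sum>l\<in>I. u l z * \<phi> (b l))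
        + (\<Sum>k\<in>I. u k x * \<phi> (b k)) * (\<Sum>l\<in>I. u l z * \<phi> (b l))"
      unfolding \<psi>_def by (simp only: left_diff_distrib right_diff_distrib)
    moreover have "(\<Sum>k\<in>I. u k x * \<phi> (b k)) * (\<Sum>l\<in>I. u l z * \<phi> (b l)) =
        (\<Sum>k\<in>I. \<Sum>l\<in>I. u k x * u l z * (\<phi> (b k) * \<phi> (b l)))"
      unfolding sum_product by (simp only: mult_ac)
    ultimately show ?thesis
      by (simp only: sum_distrib_left sum_distrib_right mult_ac)
  qed
  ultimately show ?case
    by (simp only: distrib_left sum.distrib) (simp add: algebra_simps)
qed (simp add: pd_kernel_zero)

text \<open>Agreement with a kernel is required on unit vectors only. The type argument carries the
  dimension, on which positive definiteness depends.\<close>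

definition pd_poly :: "'n::finite itself \<Rightarrow> real poly \<Rightarrow> bool" where
  "pd_poly _ p \<longleftrightarrow> (\<exists>K :: real^'n \<Rightarrow> real^'n \<Rightarrow> real. pd_kernel K \<and>
     (\<forall>x y. norm x = 1 \<longrightarrow> norm y = 1 \<longrightarrow> K x y = poly p (x \<bullet> y)))"

lemma pd_polyI:
  fixes K :: "real^'n \<Rightarrow> real^'n \<Rightarrow> real"
  assumes "pd_kernel K" "\<And>x y. norm x = 1 \<Longrightarrow> norm y = 1 \<Longrightarrow> K x y = poly p (x \<bullet> y)"
  shows "pd_poly TYPE('n) p"
  using assms unfolding pd_poly_def by blast

lemma pd_polyE:
  assumes "pd_poly TYPE('n::finite) p"
  obtains K :: "real^'n \<Rightarrow> real^'n \<Rightarrow> real"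
  where "pd_kernel K" "\<And>x y. norm x = 1 \<Longrightarrow> norm y = 1 \<Longrightarrow> K x y = poly p (x \<bullet> y)"
  using assms unfolding pd_poly_def by blast

lemma pd_poly_mult:
  assumes "pd_poly TYPE('n::finite) p" "pd_poly TYPE('n) q"
  shows "pd_poly TYPE('n) (p * q)"
proof -
  obtain K L :: "real^'n \<Rightarrow> real^'n \<Rightarrow> real" where "pd_kernel K" "pd_kernel L"
    "\<And>x y. norm x = 1 \<Longrightarrow> norm y = 1 \<Longrightarrow> K x y = poly p (x \<bullet> y)"
    "\<And>x y. norm x = 1 \<Longrightarrow> norm y = 1 \<Longrightarrow> L x y = poly q (x \<bullet> y)"
    using assms by (metis pd_polyE)
  then show ?thesis
    by (intro pd_polyI[OF pd_kernel_mult[of L K]]) auto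
qed

lemma pd_poly_sum:
  assumes "finite I" "\<And>i. i \<in> I \<Longrightarrow> 0 \<le> c i" "\<And>i. i \<in> I \<Longrightarrow> pd_poly TYPE('n::finite) (p i)"
  shows "pd_poly TYPE('n) (\<Sum>i\<in>I. smult (c i) (p i))"
proof -
  obtain K :: "_ \<Rightarrow> real^'n \<Rightarrow> real^'n \<Rightarrow> real" where K: "\<And>i. i \<in> I \<Longrightarrow> pd_kernel (K i)"
    "\<And>i x y. i \<in> I \<Longrightarrow> norm x = 1 \<Longrightarrow> norm y = 1 \<Longrightarrow> K i x y = poly (p i) (x \<bullet> y)"
    using assms(3) unfolding pd_poly_def by metis
  have "pd_kernel (\<lambda>x y. \<Sum>i\<in>I. c i * K i x y)"
    by (intro pd_kernel_sum pd_kernel_mult pd_kernel_const K assms)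
  then show ?thesis
    by (rule pd_polyI) (simp add: K poly_sum)
qed

lemma pd_poly_monom: "pd_poly TYPE('n::finite) (monom 1 k)"
  by (rule pd_polyI[OF pd_kernel_inner_power[of k]]) (simp add: poly_monom)

text \<open>A rank one kernel contributes the square of a difference of two sums. In the application
  \<open>x\<close> is a competitor and \<open>b\<close> the sharp configuration.\<close>

lemma pd_kernel_signed_sum_nonneg:
  assumes "pd_kernel K"
  shows "0 \<le> (\<Sum>i\<in>I. \<Sum>j\<in>I. K (x i) (x j)) - (\<Sum>i\<in>I. \<Sum>j\<in>J. K (x i) (b j))
    - (\<Sum>i\<in>J. \<Sum>j\<in>I. K (b i) (x j)) + (\<Sum>i\<in>J. \<Sum>j\<in>J. K (b i) (b j))"
  using assms
proof (induction rule: pd_kernel.induct)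
  case (pd_kernel_rank1 K \<phi>)
  have "0 \<le> ((\<Sum>i\<in>I. \<phi> (x i)) - (\<Sum>i\<in>J. \<phi> (b i)))\<^sup>2" by simp
  also have "\<dots> = (\<Sum>i\<in>I. \<Sum>j\<in>I. \<phi> (x i) * \<phi> (x j)) - (\<Sum>i\<in>I. \<Sum>j\<in>J. \<phi> (x i) * \<phi> (b j))
    - (\<Sum>i\<in>J. \<Sum>j\<in>I. \<phi> (b i) * \<phi> (x j)) + (\<Sum>i\<in>J. \<Sum>j\<in>J. \<phi> (b i) * \<phi> (b j))"
    by (simp add: power2_eq_square left_diff_distrib right_diff_distrib sum_product)
  finally show ?case
    using pd_kernel_rank1.IH by (simp add: sum.distrib)
qed simp

section \<open>Orthogonal polynomials on finite sets\<close>

text \<open>A strict bound in which \<open>n = 0\<close> forces the zero polynomial, which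
  \<open>degree\<close> does not separate from the constants.\<close>

definition deg_lt :: "nat \<Rightarrow> real poly \<Rightarrow> bool" where
  "deg_lt n p \<longleftrightarrow> (\<forall>i\<ge>n. coeff p i = 0)"

lemma deg_ltD: "deg_lt n p \<Longrightarrow> n \<le> i \<Longrightarrow> coeff p i = 0"
  by (simp add: deg_lt_def)

lemma deg_lt_iff: "deg_lt n p \<longleftrightarrow> p = 0 \<or> degree p < n"
  unfolding deg_lt_def by (metis coeff_0 coeff_eq_0 leading_coeff_0_iff not_le order_less_le_trans)

lemma deg_lt_degree: "degree p < n \<Longrightarrow> deg_lt n p"
  by (simp add: deg_lt_iff)

lemma deg_lt_mono: "deg_lt n p \<Longrightarrow> n \<le> k \<Longrightarrow> deg_lt k p"
  by (simp add: deg_lt_def)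

lemma deg_lt_smult: "deg_lt n p \<Longrightarrow> deg_lt n (smult c p)"
  by (simp add: deg_lt_def)

lemma deg_lt_add: "deg_lt n p \<Longrightarrow> deg_lt n q \<Longrightarrow> deg_lt n (p + q)"
  by (simp add: deg_lt_def)

lemma deg_lt_sum: "(\<And>i. i \<in> A \<Longrightarrow> deg_lt n (f i)) \<Longrightarrow> deg_lt n (\<Sum>i\<in>A. f i)"
  by (simp add: deg_lt_def coeff_sum)

lemma deg_lt_monic_diff:
  assumes "degree p = n" "lead_coeff p = 1" "degree q = n" "lead_coeff q = 1"
  shows "deg_lt n (p - q)"
  unfolding deg_lt_def using assms by (metis coeff_diff coeff_eq_0 diff_self le_neq_implies_less)

lemma deg_lt_synthetic_div: "degree q \<le> n \<Longrightarrow> deg_lt n (synthetic_div q c)"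
  by (cases "degree q = 0") (auto simp: deg_lt_iff synthetic_div_eq_0_iff degree_synthetic_div)

definition quad :: "real set \<Rightarrow> (real \<Rightarrow> real) \<Rightarrow> real poly \<Rightarrow> real" where
  "quad S w p = (\<Sum>s\<in>S. w s * poly p s)"

lemma quad_simps:
  "quad S w (p + q) = quad S w p + quad S w q"
  "quad S w (p - q) = quad S w p - quad S w q"
  "quad S w (smult c p) = c * quad S w p"
  "quad S w 0 = 0"
  by (simp_all add: quad_def algebra_simps sum.distrib sum_subtractf sum_distrib_left)

lemma quad_sum: "quad S w (\<Sum>i\<in>I. f i) = (\<Sum>i\<in>I. quad S w (f i))"
  by (induction I rule: infinite_finite_induct) (simp_all add: quad_simps)

definition orth_poly :: "real set \<Rightarrow> (real \<Rightarrow> real) \<Rightarrow> nat \<Rightarrow> real poly \<Rightarrow> bool" where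
  "orth_poly S w n q \<longleftrightarrow> degree q = n \<and> lead_coeff q = 1 \<and>
     (\<forall>p. deg_lt n p \<longrightarrow> quad S w (q * p) = 0)"

lemma quad_square_pos:
  assumes S: "finite S" "\<And>s. s \<in> S \<Longrightarrow> 0 < w s" and p: "deg_lt (card S) p" "p \<noteq> 0"
  shows "0 < quad S w (p * p)"
proof -
  have "\<exists>s\<in>S. poly p s \<noteq> 0"
  proof (rule ccontr)
    assume "\<not> ?thesis"
    then have "card S \<le> card {x. poly p x = 0}"
      using p(2) by (intro card_mono poly_roots_finite) auto
    then show False
      using card_poly_roots_bound[OF p(2)] p by (simp add: deg_lt_iff)
  qed
  then obtain s where s: "s \<in> S" "poly p s \<noteq> 0" by blast
  show ?thesis unfolding quad_def
    by (rule sum_pos2[OF S(1) s(1)])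
      (use s S(2) in \<open>auto simp: less_imp_le zero_less_mult_iff mult_less_0_iff not_less linorder_neq_iff\<close>)
qed

lemma orth_poly_nonzero: "orth_poly S w n q \<Longrightarrow> q \<noteq> 0"
  by (auto simp: orth_poly_def)

lemma orth_poly_square_pos:
  assumes "finite S" "\<And>s. s \<in> S \<Longrightarrow> 0 < w s" "orth_poly S w n q" "n < card S"
  shows "0 < quad S w (q * q)"
  using assms orth_poly_nonzero[OF assms(3)]
  by (intro quad_square_pos) (auto simp: orth_poly_def deg_lt_iff)

lemma orth_poly_orthogonal:
  assumes "orth_poly S w i p" "orth_poly S w j q" "i \<noteq> j"
  shows "quad S w (p * q) = 0"
proof (cases "i < j")
  case True
  then have "quad S w (q * p) = 0" using assms by (simp add: orth_poly_def deg_lt_degree)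
  then show ?thesis by (simp add: mult.commute)
qed (use assms in \<open>simp add: orth_poly_def deg_lt_degree\<close>)

lemma orth_poly_span:
  assumes "\<And>i. i < n \<Longrightarrow> orth_poly S w i (q i)" "deg_lt n p"
  shows "\<exists>c. p = (\<Sum>i<n. smult (c i) (q i))"
  using assms
proof (induction n arbitrary: p)
  case 0
  then show ?case by (simp add: deg_lt_def poly_eq_iff)
next
  case (Suc n)
  let ?r = "p - smult (coeff p n) (q n)"
  have qn: "degree (q n) = n" "coeff (q n) n = 1"
    using Suc.prems(1)[of n] by (auto simp: orth_poly_def)
  have "coeff ?r i = 0" if "n \<le> i" for i
    using that qn deg_ltD[OF Suc.prems(2), of i] coeff_eq_0[of "q n" i]
    by (cases "i = n") auto
  then have "deg_lt n ?r" unfolding deg_lt_def by blast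
  then obtain c where "?r = (\<Sum>i<n. smult (c i) (q i))"
    using Suc.IH Suc.prems(1) by (metis less_SucI)
  then have "p = (\<Sum>i<n. smult (c i) (q i)) + smult (coeff p n) (q n)"
    by (simp add: algebra_simps)
  also have "\<dots> = (\<Sum>i<Suc n. smult ((c(n := coeff p n)) i) (q i))" by simp
  finally show ?case by blast
qed

lemma orth_poly_expand:
  assumes S: "finite S" "\<And>s. s \<in> S \<Longrightarrow> 0 < w s" and n: "n \<le> card S"
    and q: "\<And>i. i < n \<Longrightarrow> orth_poly S w i (q i)" and p: "deg_lt n p"
  shows "p = (\<Sum>i<n. smult (quad S w (p * q i) / quad S w (q i * q i)) (q i))"
proof -
  obtain c where c: "p = (\<Sum>i<n. smult (c i) (q i))"
    using orth_poly_span[OF q p] by blast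
  have "quad S w (p * q j) = c j * quad S w (q j * q j)" if j: "j < n" for j
  proof -
    have "quad S w (p * q j) = (\<Sum>i<n. c i * quad S w (q i * q j))"
      unfolding c by (simp add: sum_distrib_right quad_sum quad_simps)
    also have "\<dots> = (\<Sum>i\<in>{j}. c i * quad S w (q i * q j))"
      using j orth_poly_orthogonal[OF q q] by (intro sum.mono_neutral_right) auto
    finally show ?thesis by simp
  qed
  then have "c j = quad S w (p * q j) / quad S w (q j * q j)" if "j < n" for j
    using orth_poly_square_pos[OF S q, of j] that n by (simp add: field_simps)
  then show ?thesis by (subst c) (intro sum.cong, auto)
qed

text \<open>Gram-Schmidt. Degree \<open>card S\<close> is still allowed, since only the squares of
  the earlier polynomials have to be positive.\<close>

lemma orth_poly_exists:
  assumes S: "finite S" "\<And>s. s \<in> S \<Longrightarrow> 0 < w s"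
  shows "n \<le> card S \<Longrightarrow> \<exists>q. orth_poly S w n q"
proof (induction n rule: less_induct)
  case (less n)
  then have "\<forall>i. \<exists>q. i < n \<longrightarrow> orth_poly S w i q" by (meson less_imp_le order_trans)
  then obtain q where q: "\<And>i. i < n \<Longrightarrow> orth_poly S w i (q i)" by metis
  define r where "r = (\<Sum>i<n. smult (quad S w (monom 1 n * q i) / quad S w (q i * q i)) (q i))"
  let ?q = "monom 1 n - r"
  have r: "deg_lt n r"
    unfolding r_def using q by (intro deg_lt_sum deg_lt_smult) (auto simp: orth_poly_def deg_lt_degree)
  have cn: "coeff ?q n = 1" using deg_ltD[OF r, of n] by simp
  moreover have "coeff ?q i = 0" if "n < i" for i using deg_ltD[OF r, of i] that by simp
  ultimately have deg: "degree ?q = n"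
    by (intro antisym degree_le le_degree) auto
  have orth: "quad S w (?q * q j) = 0" if j: "j < n" for j
  proof -
    have "quad S w (r * q j) = (\<Sum>i<n. quad S w (monom 1 n * q i) / quad S w (q i * q i) * quad S w (q i * q j))"
      unfolding r_def by (simp add: sum_distrib_right quad_sum quad_simps)
    also have "\<dots> = (\<Sum>i\<in>{j}. quad S w (monom 1 n * q i) / quad S w (q i * q i) * quad S w (q i * q j))"
      using j orth_poly_orthogonal[OF q q] by (intro sum.mono_neutral_right) auto
    also have "\<dots> = quad S w (monom 1 n * q j)"
      using orth_poly_square_pos[OF S q[OF j]] j less.prems by simp
    finally show ?thesis by (simp add: left_diff_distrib quad_simps)
  qed
  have "quad S w (?q * p) = 0" if p: "deg_lt n p" for p
  proof -
    obtain c where c: "p = (\<Sum>i<n. smult (c i) (q i))"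
      using orth_poly_span[OF q p] by blast
    have "quad S w (?q * p) = (\<Sum>i<n. c i * quad S w (?q * q i))"
      unfolding c by (simp add: sum_distrib_left quad_sum quad_simps)
    then show ?thesis using orth by simp
  qed
  with deg cn show ?case unfolding orth_poly_def by auto
qed

text \<open>All real roots lie strictly left of an upper bound of the support. A root
  \<open>a\<close> at or beyond \<open>M\<close> would give \<open>q = (t - a) u\<close>, and
  pairing \<open>q\<close> with \<open>u\<close>, of lower degree, would be negative instead of
  0.\<close>

lemma orth_poly_pos_right:
  assumes S: "finite S" "\<And>s. s \<in> S \<Longrightarrow> 0 < w s" and M: "\<And>s. s \<in> S \<Longrightarrow> s \<le> M"
    and q: "orth_poly S w n q" and n: "n < card S"
  shows "0 < poly q M"
proof (rule ccontr)
  assume neg: "\<not> 0 < poly q M"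
  have lead: "lead_coeff q = 1" and deg: "degree q = n" using q by (auto simp: orth_poly_def)
  obtain B where B: "\<And>x. B \<le> x \<Longrightarrow> lead_coeff q \<le> poly q x"
    using poly_pinfty_gt_lc[of q] lead by auto
  define b where "b = max B (M + 1)"
  have b: "M < b" "0 < poly q b" using B[of b] lead by (auto simp: b_def)
  obtain a where a: "M \<le> a" "poly q a = 0"
  proof (cases "poly q M = 0")
    case True
    then show thesis using that[of M] by simp
  next
    case False
    then show thesis using neg poly_IVT_pos[OF b(1), of q] b(2) that less_imp_le not_less_iff_gr_or_eq
      by metis
  qed
  define u where "u = synthetic_div q a"
  have qu: "q = [:-a, 1:] * u"
    using synthetic_div_correct'[of a q] a(2) by (simp add: u_def)
  have "u \<noteq> 0" using qu lead by auto
  have degu: "n = Suc (degree u)"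
    using deg \<open>u \<noteq> 0\<close> unfolding qu by (subst (asm) degree_mult_eq) auto
  \<comment> \<open>Strictness: \<open>u\<close> has at most \<open>card S - 2\<close> roots, too
    few to cover \<open>S - {a}\<close>.\<close>
  have "\<exists>s\<in>S - {a}. poly u s \<noteq> 0"
  proof (rule ccontr)
    assume "\<not> ?thesis"
    then have "card (S - {a}) \<le> card {x. poly u x = 0}"
      using \<open>u \<noteq> 0\<close> by (intro card_mono poly_roots_finite) auto
    moreover have "card S - 1 \<le> card (S - {a})"
      by (simp add: card_Diff_singleton_if)
    ultimately show False
      using card_poly_roots_bound[OF \<open>u \<noteq> 0\<close>] degu n by simp
  qed
  then obtain s where s: "s \<in> S" "s \<noteq> a" "poly u s \<noteq> 0" by blast
  have "0 < (\<Sum>s\<in>S. w s * ((a - s) * (poly u s)\<^sup>2))"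
  proof (rule sum_pos2[OF S(1) s(1)])
    have "s < a" using s M a(1) by force
    then show "0 < w s * ((a - s) * (poly u s)\<^sup>2)" using S(2) s by simp
    show "0 \<le> w i * ((a - i) * (poly u i)\<^sup>2)" if "i \<in> S" for i
      using S(2)[OF that] M[OF that] a(1) by simp
  qed
  also have "\<dots> = - quad S w (q * u)"
    unfolding quad_def qu sum_negf[symmetric]
    by (intro sum.cong) (auto simp: algebra_simps power2_eq_square)
  also have "\<dots> = 0"
    using q degu by (simp add: orth_poly_def deg_lt_degree)
  finally show False by simp
qed

section \<open>Positivity of prefix products in the orthogonal basis\<close>

definition root_poly :: "real set \<Rightarrow> real poly" where
  "root_poly A = (\<Prod>a\<in>A. [:- a, 1:])"

lemma degree_root_poly [simp]: "degree (root_poly A) = card A"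
  unfolding root_poly_def by (subst degree_prod_eq_sum_degree) auto

lemma poly_root_poly: "poly (root_poly A) t = (\<Prod>a\<in>A. t - a)"
  by (simp add: root_poly_def poly_prod)

text \<open>\<open>p\<close> is a kernel polynomial in the sense of Christoffel: orthogonality for
  the measure damped by \<open>M - s\<close> makes it, up to a factor, the reproducing kernel at
  \<open>M\<close> in degrees up to \<open>i\<close>. Pairing with \<open>q\<close> thus evaluates
  \<open>q\<close> at \<open>M\<close>, where it is positive.\<close>

lemma quad_orth_poly_tail_nonneg:
  fixes w :: "real \<Rightarrow> real" and M :: real and S :: "real set"
  defines "S' \<equiv> S - {M}" and "w' \<equiv> \<lambda>s. w s * (M - s)"
  assumes S: "finite S" "\<And>s. s \<in> S \<Longrightarrow> 0 < w s" and M: "M \<in> S" "\<And>s. s \<in> S \<Longrightarrow> s \<le> M"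
    and p: "orth_poly S' w' i p" and q: "orth_poly S w j q" and ij: "i < card S" "j < card S"
  shows "0 \<le> quad S w (p * q)"
proof (cases "i < j")
  case True
  then have "quad S w (q * p) = 0" using q p by (simp add: orth_poly_def deg_lt_degree)
  then show ?thesis by (simp add: mult.commute)
next
  case False
  have quad': "quad S' w' r = quad S w ([:M, -1:] * r)" for r
    unfolding quad_def S'_def w'_def using S(1) M(1)
    by (subst sum.remove[of S M]) (auto intro!: sum.cong simp: algebra_simps)
  \<comment> \<open>Splitting off the value of \<open>r\<close> at \<open>M\<close> leaves a
    multiple of \<open>t - M\<close>, which \<open>p\<close> annihilates by the choice of
    \<open>w'\<close>.\<close>
  have red: "quad S w (p * r) = poly r M * quad S w p" if "orth_poly S w k r" "k \<le> i" for r k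
  proof -
    define u where "u = synthetic_div r M"
    have r: "r = [:poly r M:] + [:-M, 1:] * u"
      using synthetic_div_correct'[of M r] by (simp add: u_def)
    have "deg_lt i u"
      unfolding u_def using that by (intro deg_lt_synthetic_div) (auto simp: orth_poly_def)
    then have "quad S' w' (p * u) = 0" using p by (simp add: orth_poly_def)
    moreover have "p * r = smult (poly r M) p - [:M, -1:] * (p * u)"
      by (subst r) (simp add: algebra_simps)
    ultimately show ?thesis
      unfolding quad' by (simp only: quad_simps)
  qed
  \<comment> \<open>The remaining factor \<open>quad S w p\<close> is positive: tested against the
    orthogonal polynomial of the same degree, the pairing becomes a square.\<close>
  obtain r where r: "orth_poly S w i r"
    using orth_poly_exists[where S=S and w=w and n=i] S ij(1) less_imp_le by blast
  have "deg_lt i (p - r)"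
    using p r by (intro deg_lt_monic_diff) (auto simp: orth_poly_def)
  then have "quad S w (r * (p - r)) = 0" using r by (simp add: orth_poly_def)
  then have "quad S w (p * r) = quad S w (r * r)"
    by (simp add: right_diff_distrib quad_simps mult.commute)
  then have "0 < poly r M * quad S w p"
    using orth_poly_square_pos[OF S r ij(1)] red[OF r] by simp
  then have "0 < quad S w p"
    using orth_poly_pos_right[OF S M(2) r ij(1)] by (simp add: zero_less_mult_iff)
  then show ?thesis
    using red[OF q] False orth_poly_pos_right[OF S M(2) q ij(2)] by simp
qed

text \<open>Induction on \<open>card S\<close>, removing the largest point. For the damped measure
  the coefficients of \<open>root_poly A\<close> are nonnegative by hypothesis, and
  \<open>quad_orth_poly_tail_nonneg\<close> carries this back to \<open>S\<close>.\<close>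

lemma quad_root_poly_orth_poly_nonneg:
  fixes w :: "real \<Rightarrow> real"
  assumes "finite S" "\<And>s. s \<in> S \<Longrightarrow> 0 < w s" "A \<subset> S" "\<And>a b. a \<in> A \<Longrightarrow> b \<in> S - A \<Longrightarrow> a < b"
    and "orth_poly S w j q" "j < card S"
  shows "0 \<le> quad S w (root_poly A * q)"
  using assms
proof (induction "card S" arbitrary: S w j q rule: less_induct)
  case less
  note S = less.prems(1,2) and q = less.prems(5) and j = less.prems(6)
  define M where "M = Max S"
  have "S \<noteq> {}" using less.prems(3) by blast
  then have M: "M \<in> S" "\<And>s. s \<in> S \<Longrightarrow> s \<le> M" using S(1) by (auto simp: M_def)
  have "M \<notin> A"
    using less.prems(3,4) M(2) by (metis DiffI leD psubset_imp_ex_mem DiffD1)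
  show ?case
  proof (cases "A = S - {M}")
    \<comment> \<open>Here \<open>A\<close> is no longer a strict prefix after removal of
      \<open>M\<close>, but the only point contributing to the sum is \<open>M\<close>.\<close>
    case True
    have "quad S w (root_poly A * q) = w M * (poly (root_poly A) M * poly q M)"
      unfolding quad_def using S(1) M(1) True
      by (subst sum.remove[of S M]) (auto simp: poly_root_poly intro!: sum.neutral)
    moreover have "0 < poly (root_poly A) M"
      unfolding poly_root_poly using True M(2) by (intro prod_pos) force
    ultimately show ?thesis
      using orth_poly_pos_right[OF S M(2) q j] S(2)[OF M(1)] by simp
  next
    case False
    define S' where "S' = S - {M}"
    define w' where "w' = (\<lambda>s. w s * (M - s))"
    have S': "finite S'" "\<And>s. s \<in> S' \<Longrightarrow> 0 < w' s" "card S' < card S"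
      using S M card_Diff1_less[OF S(1) M(1)] unfolding S'_def w'_def
      by (auto simp: less_le)
    have A: "A \<subset> S'" "\<And>a b. a \<in> A \<Longrightarrow> b \<in> S' - A \<Longrightarrow> a < b"
      using False less.prems(3,4) \<open>M \<notin> A\<close> by (auto simp: S'_def)
    have "\<exists>p. orth_poly S' w' i p" if "i < card S'" for i
      using orth_poly_exists[where S=S' and w=w' and n=i] S'(1,2) that less_imp_le by blast
    then obtain p where p: "\<And>i. i < card S' \<Longrightarrow> orth_poly S' w' i (p i)" by metis
    define c where "c i = quad S' w' (root_poly A * p i) / quad S' w' (p i * p i)" for i
    have c: "0 \<le> c i" if "i < card S'" for i
      unfolding c_def using less.hyps[OF S'(3,1,2) A p[OF that] that]
        orth_poly_square_pos[OF S'(1,2) p[OF that] that] by simp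
    have "deg_lt (card S') (root_poly A)"
      using psubset_card_mono[OF S'(1) A(1)] by (simp add: deg_lt_degree)
    then have "root_poly A = (\<Sum>i<card S'. smult (c i) (p i))"
      unfolding c_def by (intro orth_poly_expand[OF S'(1,2) _ p]) auto
    then have "quad S w (root_poly A * q) = (\<Sum>i<card S'. c i * quad S w (p i * q))"
      by (simp add: sum_distrib_right quad_sum quad_simps)
    also have "\<dots> \<ge> 0"
    proof (intro sum_nonneg mult_nonneg_nonneg)
      fix i assume "i \<in> {..<card S'}"
      then have i: "i < card S'" by simp
      show "0 \<le> c i" using c[OF i] .
      show "0 \<le> quad S w (p i * q)"
        using quad_orth_poly_tail_nonneg[OF S M p[OF i, unfolded S'_def w'_def] q _ j] i S'(3) by simp
    qed
    finally show ?thesis .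
  qed
qed

section \<open>Newton interpolation of absolutely monotone functions\<close>

text \<open>Order 0 is exempt from the sign condition because \<open>f\<close> is completely
  monotone only up to a constant. The endpoint 1 is left out because \<open>f\<close> need not be
  differentiable at 0.\<close>

definition abs_mono :: "(nat \<Rightarrow> real \<Rightarrow> real) \<Rightarrow> bool" where
  "abs_mono D \<longleftrightarrow>
     (\<forall>k. \<forall>t\<in>{-1..<1}. (D k has_real_derivative D (Suc k) t) (at t within {-1..<1})) \<and>
     (\<forall>k\<ge>1. \<forall>t\<in>{-1..<1}. 0 \<le> D k t)"

definition strict_abs_mono :: "(nat \<Rightarrow> real \<Rightarrow> real) \<Rightarrow> bool" where
  "strict_abs_mono D \<longleftrightarrow> abs_mono D \<and> (\<forall>k\<ge>1. \<forall>t\<in>{-1<..<1}. 0 < D k t)"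

text \<open>For a sequence of derivatives this is the \<open>k\<close>-th derivative in
  \<open>t\<close> of \<open>(D 0 t - D 0 a) / (t - a)\<close>. The integral form covers
  \<open>t = a\<close>, so repeated nodes need no separate treatment, and it shows the sign of every
  derivative.\<close>

definition diff_quot :: "real \<Rightarrow> (nat \<Rightarrow> real \<Rightarrow> real) \<Rightarrow> nat \<Rightarrow> real \<Rightarrow> real" where
  "diff_quot a D k t = integral {0..1} (\<lambda>s. s ^ k * D (Suc k) (a + s * (t - a)))"

lemma segment_in_interval:
  fixes a t s :: real
  assumes "a \<in> {-1..<1}" "t \<in> {-1..<1}" "s \<in> {0..1}"
  shows "a + s * (t - a) \<in> {-1..<1}"
proof -
  have "convex {-1..<1::real}" by simp
  then have "(1 - s) *\<^sub>R a + s *\<^sub>R t \<in> {-1..<1}"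
    using assms by (intro convexD_alt) auto
  then show ?thesis by (simp add: algebra_simps)
qed

lemma abs_mono_continuous:
  assumes "abs_mono D"
  shows "continuous_on {-1..<1} (D k)"
  using assms unfolding abs_mono_def by (intro DERIV_continuous_on) blast

lemma continuous_diff_quot_integrand:
  assumes D: "abs_mono D" and a: "a \<in> {-1..<1}"
  shows "continuous_on ({-1..<1} \<times> {0..1}) (\<lambda>(t, s). s ^ j * D k (a + s * (t - a)))"
proof -
  have "continuous_on ({-1..<1} \<times> {0..1}) (\<lambda>z. D k (a + snd z * (fst z - a)))"
    by (rule continuous_on_compose2[OF abs_mono_continuous[OF D]])
      (auto intro!: continuous_intros simp del: atLeastLessThan_iff
        intro: segment_in_interval[OF a])
  then have "continuous_on ({-1..<1} \<times> {0..1}) (\<lambda>z. snd z ^ j * D k (a + snd z * (fst z - a)))"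
    by (intro continuous_intros)
  then show ?thesis by (simp add: case_prod_beta)
qed

lemma continuous_diff_quot_integrand':
  assumes D: "abs_mono D" and a: "a \<in> {-1..<1}" and t: "t \<in> {-1..<1}"
  shows "continuous_on {0..1} (\<lambda>s. s ^ j * D k (a + s * (t - a)))"
proof -
  have "continuous_on {0..1} (\<lambda>s. (\<lambda>(t, s). s ^ j * D k (a + s * (t - a))) (t, s))"
    by (rule continuous_on_compose2[OF continuous_diff_quot_integrand[OF D a]])
      (use t in \<open>auto intro!: continuous_intros\<close>)
  then show ?thesis by simp
qed

lemma diff_quot_deriv:
  assumes D: "abs_mono D" and a: "a \<in> {-1..<1}" and t: "t \<in> {-1..<1}"
  shows "(diff_quot a D k has_real_derivative diff_quot a D (Suc k) t) (at t within {-1..<1})"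
proof -
  have "((\<lambda>t. integral (cbox 0 1) (\<lambda>s. s ^ k * D (Suc k) (a + s * (t - a))))
      has_field_derivative integral (cbox 0 1) (\<lambda>s. s ^ Suc k * D (Suc (Suc k)) (a + s * (t - a))))
      (at t within {-1..<1})"
  proof (rule leibniz_rule_field_derivative)
    fix x s :: real
    assume x: "x \<in> {-1..<1}" and s: "s \<in> cbox 0 1"
    have img: "(\<lambda>x. a + s * (x - a)) ` {-1..<1} \<subseteq> {-1..<1}"
      using segment_in_interval[OF a] s by (auto simp del: atLeastLessThan_iff)
    have "(D (Suc k) has_real_derivative D (Suc (Suc k)) (a + s * (x - a)))
        (at (a + s * (x - a)) within {-1..<1})"
      using D segment_in_interval[OF a x] s unfolding abs_mono_def by simp
    then have "(D (Suc k) has_real_derivative D (Suc (Suc k)) (a + s * (x - a)))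
        (at (a + s * (x - a)) within (\<lambda>x. a + s * (x - a)) ` {-1..<1})"
      using img by (rule DERIV_subset)
    moreover have "((\<lambda>x. a + s * (x - a)) has_real_derivative s) (at x within {-1..<1})"
      by (auto intro!: derivative_eq_intros)
    ultimately have "((\<lambda>x. D (Suc k) (a + s * (x - a))) has_real_derivative
        D (Suc (Suc k)) (a + s * (x - a)) * s) (at x within {-1..<1})"
      using DERIV_image_chain[of "D (Suc k)" _ "\<lambda>x. a + s * (x - a)"] by (simp add: o_def)
    then show "((\<lambda>x. s ^ k * D (Suc k) (a + s * (x - a))) has_field_derivative
        s ^ Suc k * D (Suc (Suc k)) (a + s * (x - a))) (at x within {-1..<1})"
      by (auto intro!: derivative_eq_intros)
  next
    fix x :: real assume "x \<in> {-1..<1}"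
    then show "(\<lambda>s. s ^ k * D (Suc k) (a + s * (x - a))) integrable_on cbox 0 1"
      using integrable_continuous_real[OF continuous_diff_quot_integrand'[OF D a]] by simp
  next
    show "continuous_on ({-1..<1} \<times> cbox 0 1) (\<lambda>(x, s). s ^ Suc k * D (Suc (Suc k)) (a + s * (x - a)))"
      unfolding cbox_interval by (rule continuous_diff_quot_integrand[OF D a])
  qed (use t in auto)
  then show ?thesis by (simp add: diff_quot_def[abs_def])
qed

lemma diff_quot_nonneg:
  assumes D: "abs_mono D" and a: "a \<in> {-1..<1}" and t: "t \<in> {-1..<1}"
  shows "0 \<le> diff_quot a D k t"
proof -
  have "(\<lambda>s. s ^ k * D (Suc k) (a + s * (t - a))) integrable_on {0..1}"
    using continuous_diff_quot_integrand'[OF D a t] by (rule integrable_continuous_real)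
  then show ?thesis
    unfolding diff_quot_def
    by (rule integral_nonneg) (use D segment_in_interval[OF a t] in \<open>auto simp: abs_mono_def\<close>)
qed

text \<open>By continuity one point with positive integrand suffices. At \<open>s = 1/2\<close> the
  argument is the midpoint of \<open>a\<close> and \<open>t\<close>, which is interior unless both
  are \<open>-1\<close>, where strictness is not assumed.\<close>

lemma diff_quot_pos:
  assumes D: "strict_abs_mono D" and a: "a \<in> {-1..<1}" and t: "t \<in> {-1..<1}"
    and "a \<noteq> -1 \<or> t \<noteq> -1"
  shows "0 < diff_quot a D k t"
proof -
  let ?h = "\<lambda>s. s ^ k * D (Suc k) (a + s * (t - a))"
  have D': "abs_mono D" using D by (simp add: strict_abs_mono_def)
  have nonneg: "\<forall>s\<in>cbox 0 1. 0 \<le> ?h s"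
    using D' segment_in_interval[OF a t] by (auto simp: abs_mono_def)
  have "a + 1/2 * (t - a) \<in> {-1<..<1}" using assms(2-4) by (auto simp: field_simps)
  then have "?h (1/2) > 0"
    using D unfolding strict_abs_mono_def by auto
  then have "\<exists>s\<in>cbox 0 1. ?h s \<noteq> 0" by (intro bexI[of _ "1/2"]) auto
  then have "integral (cbox 0 1) ?h \<noteq> 0"
    using continuous_diff_quot_integrand'[OF D' a t] nonneg
    by (subst integral_cbox_eq_0_iff) auto
  then show ?thesis
    using diff_quot_nonneg[OF D' a t, of k] by (simp add: diff_quot_def)
qed

lemma abs_mono_diff_quot:
  assumes "abs_mono D" "a \<in> {-1..<1}"
  shows "abs_mono (diff_quot a D)"
  unfolding abs_mono_def using diff_quot_deriv[OF assms] diff_quot_nonneg[OF assms] by blast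

lemma strict_abs_mono_diff_quot:
  assumes "strict_abs_mono D" "a \<in> {-1..<1}"
  shows "strict_abs_mono (diff_quot a D)"
  unfolding strict_abs_mono_def
  using abs_mono_diff_quot[of D a] diff_quot_pos[OF assms] assms
  by (auto simp: strict_abs_mono_def)

lemma diff_quot_expand:
  assumes D: "abs_mono D" and a: "a \<in> {-1..<1}" and t: "t \<in> {-1..<1}"
  shows "D 0 t = D 0 a + (t - a) * diff_quot a D 0 t"
proof -
  have "((\<lambda>s. (t - a) * D 1 (a + s * (t - a))) has_integral
      D 0 (a + 1 * (t - a)) - D 0 (a + 0 * (t - a))) {0..1}"
  proof (rule fundamental_theorem_of_calculus)
    fix s :: real assume s: "s \<in> {0..1}"
    have img: "(\<lambda>s. a + s * (t - a)) ` {0..1} \<subseteq> {-1..<1}"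
      using segment_in_interval[OF a t] by (auto simp del: atLeastLessThan_iff)
    have "(D 0 has_real_derivative D 1 (a + s * (t - a))) (at (a + s * (t - a)) within {-1..<1})"
      using D segment_in_interval[OF a t s] unfolding abs_mono_def by simp
    then have "(D 0 has_real_derivative D 1 (a + s * (t - a)))
        (at (a + s * (t - a)) within (\<lambda>s. a + s * (t - a)) ` {0..1})"
      using img by (rule DERIV_subset)
    moreover have "((\<lambda>s. a + s * (t - a)) has_real_derivative t - a) (at s within {0..1})"
      by (auto intro!: derivative_eq_intros)
    ultimately have "((\<lambda>s. D 0 (a + s * (t - a))) has_real_derivative
        D 1 (a + s * (t - a)) * (t - a)) (at s within {0..1})"
      using DERIV_image_chain[of "D 0" _ "\<lambda>s. a + s * (t - a)"] by (simp add: o_def)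
    then show "((\<lambda>s. D 0 (a + s * (t - a))) has_vector_derivative
        (t - a) * D 1 (a + s * (t - a))) (at s within {0..1})"
      by (simp add: has_real_derivative_iff_has_vector_derivative mult.commute)
  qed simp
  then have "integral {0..1} (\<lambda>s. (t - a) * D 1 (a + s * (t - a))) =
      D 0 (a + 1 * (t - a)) - D 0 (a + 0 * (t - a))"
    by (rule integral_unique)
  then show ?thesis by (simp add: diff_quot_def)
qed

text \<open>Divided differences over \<open>a 0, ..., a (n - 1)\<close> and a free last point
  \<open>t\<close>, with derivatives of order \<open>k\<close> in \<open>t\<close>. For
  \<open>k = 0\<close> and \<open>t = a n\<close> this is the Newton coefficient.\<close>

fun iter_diff_quot :: "(nat \<Rightarrow> real) \<Rightarrow> (nat \<Rightarrow> real \<Rightarrow> real) \<Rightarrow> nat \<Rightarrow> nat \<Rightarrow> real \<Rightarrow> real" where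
  "iter_diff_quot a D 0 = D"
| "iter_diff_quot a D (Suc n) = diff_quot (a n) (iter_diff_quot a D n)"

lemma abs_mono_iter_diff_quot:
  assumes "abs_mono D" "\<And>i. i < n \<Longrightarrow> a i \<in> {-1..<1}"
  shows "abs_mono (iter_diff_quot a D n)"
  using assms by (induction n) (auto intro!: abs_mono_diff_quot)

lemma strict_abs_mono_iter_diff_quot:
  assumes "strict_abs_mono D" "\<And>i. i < n \<Longrightarrow> a i \<in> {-1..<1}"
  shows "strict_abs_mono (iter_diff_quot a D n)"
  using assms by (induction n) (auto intro!: strict_abs_mono_diff_quot)

lemma iter_diff_quot_nonneg:
  assumes "abs_mono D" "\<And>i. i < n \<Longrightarrow> a i \<in> {-1..<1}" "1 \<le> n" "t \<in> {-1..<1}"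
  shows "0 \<le> iter_diff_quot a D n k t"
proof (cases n)
  case (Suc n')
  then show ?thesis
    using assms abs_mono_iter_diff_quot[of D n' a] by (auto intro!: diff_quot_nonneg)
qed (use assms in simp)

lemma iter_diff_quot_pos:
  assumes "strict_abs_mono D" "\<And>i. i < n \<Longrightarrow> a i \<in> {-1..<1}" "1 \<le> n" "t \<in> {-1..<1}"
    and "a (n - 1) \<noteq> -1 \<or> t \<noteq> -1"
  shows "0 < iter_diff_quot a D n k t"
proof (cases n)
  case (Suc n')
  then show ?thesis
    using assms strict_abs_mono_iter_diff_quot[of D n' a] by (auto intro!: diff_quot_pos)
qed (use assms in simp)

lemma iter_diff_quot_mono:
  assumes "abs_mono D" "\<And>i. i < n \<Longrightarrow> a i \<in> {-1..<1}" "-1 \<le> s" "s \<le> t" "t < 1"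
  shows "iter_diff_quot a D n 0 s \<le> iter_diff_quot a D n 0 t"
proof -
  let ?R = "iter_diff_quot a D n"
  have R: "abs_mono ?R" using assms abs_mono_iter_diff_quot by blast
  show ?thesis
  proof (rule DERIV_nonneg_imp_increasing_open[OF assms(4)])
    fix x assume x: "s < x" "x < t"
    then have "(?R 0 has_real_derivative ?R 1 x) (at x within {-1..<1})" "0 \<le> ?R 1 x"
      using R assms unfolding abs_mono_def by auto
    moreover have "at x within {-1..<1} = at x"
      by (rule at_within_interior) (use x assms in simp)
    ultimately show "\<exists>y. (?R 0 has_real_derivative y) (at x) \<and> 0 \<le> y" by metis
  next
    show "continuous_on {s..t} (?R 0)"
      by (rule continuous_on_subset[OF abs_mono_continuous[OF R]]) (use assms in auto)
  qed
qed

text \<open>Indexed by a sequence so that nodes may repeat, unlike \<open>root_poly\<close>.\<close>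

definition node_poly :: "(nat \<Rightarrow> real) \<Rightarrow> nat \<Rightarrow> real poly" where
  "node_poly a n = (\<Prod>i<n. [:- a i, 1:])"

definition newton_poly :: "(nat \<Rightarrow> real) \<Rightarrow> (nat \<Rightarrow> real \<Rightarrow> real) \<Rightarrow> nat \<Rightarrow> real poly" where
  "newton_poly a D n = (\<Sum>k<n. smult (iter_diff_quot a D k 0 (a k)) (node_poly a k))"

lemma poly_node_poly: "poly (node_poly a n) t = (\<Prod>i<n. t - a i)"
  by (simp add: node_poly_def poly_prod)

lemma degree_node_poly [simp]: "degree (node_poly a n) = n"
  unfolding node_poly_def by (subst degree_prod_eq_sum_degree) auto

lemma lead_coeff_node_poly [simp]: "lead_coeff (node_poly a n) = 1"
  unfolding node_poly_def by (subst lead_coeff_prod) simp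

lemma degree_newton_poly: "degree (newton_poly a D n) \<le> n - 1"
  unfolding newton_poly_def
proof (rule degree_sum_le)
  fix k assume "k \<in> {..<n}"
  then show "degree (smult (iter_diff_quot a D k 0 (a k)) (node_poly a k)) \<le> n - 1"
    using degree_smult_le[of "iter_diff_quot a D k 0 (a k)" "node_poly a k"] by simp
qed simp

lemma newton_expansion:
  assumes "abs_mono D" "\<And>i. i < n \<Longrightarrow> a i \<in> {-1..<1}" "t \<in> {-1..<1}"
  shows "D 0 t = poly (newton_poly a D n) t + poly (node_poly a n) t * iter_diff_quot a D n 0 t"
  using assms
proof (induction n)
  case 0
  then show ?case by (simp add: newton_poly_def node_poly_def)
next
  case (Suc n)
  have "iter_diff_quot a D n 0 t = iter_diff_quot a D n 0 (a n) + (t - a n) * iter_diff_quot a D (Suc n) 0 t"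
    using diff_quot_expand[of "iter_diff_quot a D n" "a n" t] Suc.prems
      abs_mono_iter_diff_quot[of D n a] by simp
  with Suc.IH Suc.prems show ?case
    by (simp add: newton_poly_def node_poly_def algebra_simps)
qed

text \<open>At 1 only continuity of \<open>g\<close> is known. The number \<open>c\<close> replaces
  the remainder there: it is its left limit, and an upper bound because the remainder is
  nondecreasing.\<close>

lemma newton_endpoint:
  assumes D: "abs_mono D" and a: "\<And>i. i < n \<Longrightarrow> a i \<in> {-1..<1}"
    and g: "continuous_on {-1..1} g" "\<And>t. t \<in> {-1..<1} \<Longrightarrow> g t = D 0 t"
  obtains c where "g 1 = poly (newton_poly a D n) 1 + poly (node_poly a n) 1 * c"
    "\<And>t. t \<in> {-1..<1} \<Longrightarrow> iter_diff_quot a D n 0 t \<le> c"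
proof -
  let ?H = "poly (newton_poly a D n)" and ?P = "poly (node_poly a n)" and ?R = "iter_diff_quot a D n 0"
  define c where "c = (g 1 - ?H 1) / ?P 1"
  have P1: "?P 1 > 0"
    unfolding poly_node_poly using a by (intro prod_pos) auto
  have "(g \<longlongrightarrow> g 1) (at 1 within {-1..1})"
    using g(1) by (simp add: continuous_on_def)
  moreover have "at (1::real) within {-1..1} = at_left 1"
    by (rule at_within_Icc_at_left) simp
  ultimately have glim: "(g \<longlongrightarrow> g 1) (at_left 1)" by simp
  have plim: "(poly p \<longlongrightarrow> poly p 1) (at_left 1)" for p :: "real poly"
  proof -
    have "isCont (poly p) 1" by (rule poly_isCont)
    then show ?thesis unfolding isCont_def by (simp add: filterlim_at_split)
  qed
  have lim: "((\<lambda>t. (g t - ?H t) / ?P t) \<longlongrightarrow> c) (at_left 1)"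
    unfolding c_def using P1 by (intro tendsto_intros glim plim) simp
  have evP: "eventually (\<lambda>t. 0 < ?P t) (at_left 1)"
    using plim P1 by (rule order_tendstoD)
  have ev: "eventually (\<lambda>u. u \<in> {t<..<1}) (at_left 1)" if "t < 1" for t :: real
    using that by (rule eventually_at_left_real)
  have "?R t \<le> c" if t: "t \<in> {-1..<1}" for t
  proof (rule tendsto_lowerbound[OF lim])
    have t1: "t < 1" using t by simp
    show "eventually (\<lambda>u. ?R t \<le> (g u - ?H u) / ?P u) (at_left 1)"
      using evP ev[OF t1]
    proof eventually_elim
      case (elim u)
      have u: "u \<in> {-1..<1}" using elim t by auto
      have "g u - ?H u = ?P u * ?R u"
        using newton_expansion[where n=n, OF D a u] g(2)[OF u] by simp
      then have "(g u - ?H u) / ?P u = ?R u" using elim by simp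
      then show ?case using iter_diff_quot_mono[where n=n and s=t and t=u, OF D a] t elim by auto
    qed
  qed simp
  then show thesis using that[of c] P1 by (simp add: c_def)
qed

section \<open>Sharp configurations\<close>

locale sharp_configuration =
  fixes b :: "nat \<Rightarrow> real^'n" and N m :: nat
  assumes dim_ge_2: "2 \<le> CARD('n)" and m_ge_1: "1 \<le> m" and sharp: "m_sharp N b m"
begin

definition dots :: "real set" where "dots = dot_products N b"

text \<open>Adding 1 accounts for the pairs \<open>i = j\<close>: \<open>L\<close> then sums over
  all ordered pairs, and with \<open>m + 1\<close> points it is definite up to degree
  \<open>m\<close>.\<close>

definition nodes :: "real set" where "nodes = insert 1 dots"

definition weight :: "real \<Rightarrow> real" where
  "weight s = real (card {(i, j) \<in> {..<N} \<times> {..<N}. b i \<bullet> b j = s})"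

abbreviation L :: "real poly \<Rightarrow> real" where "L \<equiv> quad nodes weight"

lemma design: "spherical_design N b (2 * m - 1)" and inj_b: "inj_on b {..<N}"
  and card_dots: "card dots = m"
  using sharp by (simp_all add: m_sharp_def dots_def)

lemma norm_b [simp]: "i < N \<Longrightarrow> norm (b i) = 1"
  using design by (simp add: spherical_design_def on_sphere_def)

lemma inner_b_self [simp]: "i < N \<Longrightarrow> b i \<bullet> b i = 1"
  using norm_b norm_eq_1 by blast

lemma finite_dots [simp]: "finite dots"
  using card_dots m_ge_1 by (intro card_ge_0_finite) simp

lemma dots_range:
  assumes "t \<in> dots"
  shows "-1 \<le> t" "t < 1"
proof -
  obtain i j where ij: "i < N" "j < N" "i \<noteq> j" "t = b i \<bullet> b j"
    using assms by (auto simp: dots_def dot_products_def)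
  then have "\<bar>t\<bar> \<le> 1" using Cauchy_Schwarz_ineq2[of "b i" "b j"] by simp
  then show "-1 \<le> t" by simp
  have "b i \<noteq> b j" using ij inj_b by (auto simp: inj_on_def)
  then have "0 < (norm (b i - b j))\<^sup>2" by simp
  also have "\<dots> = 2 - 2 * t"
    using ij by (simp add: power2_norm_eq_inner inner_diff_left inner_diff_right inner_commute[of "b j" "b i"])
  finally show "t < 1" by simp
qed

lemma N_pos: "0 < N"
proof -
  have "dots \<noteq> {}" using card_dots m_ge_1 by auto
  then show ?thesis by (auto simp: dots_def dot_products_def)
qed

lemma finite_nodes [simp]: "finite nodes"
  by (simp add: nodes_def)

lemma one_notin_dots: "1 \<notin> dots"
  using dots_range(2) by blast

lemma card_nodes: "card nodes = Suc m"
  using one_notin_dots by (simp add: nodes_def card_dots)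

lemma inner_b_nodes: "i < N \<Longrightarrow> j < N \<Longrightarrow> b i \<bullet> b j \<in> nodes"
  by (cases "i = j") (auto simp: nodes_def dots_def dot_products_def)

lemma weight_pos: "s \<in> nodes \<Longrightarrow> 0 < weight s"
proof -
  assume "s \<in> nodes"
  then consider "s = 1" | "s \<in> dots" by (auto simp: nodes_def)
  then have "\<exists>i j. i < N \<and> j < N \<and> b i \<bullet> b j = s"
  proof cases
    case 1
    then show ?thesis using N_pos inner_b_self[of 0] by blast
  qed (auto simp: dots_def dot_products_def)
  then have "{(i, j) \<in> {..<N} \<times> {..<N}. b i \<bullet> b j = s} \<noteq> {}" by auto
  moreover have "finite {(i, j) \<in> {..<N} \<times> {..<N}. b i \<bullet> b j = s}"
    by (rule finite_subset[of _ "{..<N} \<times> {..<N}"]) auto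
  ultimately have "0 < card {(i, j) \<in> {..<N} \<times> {..<N}. b i \<bullet> b j = s}"
    unfolding card_gt_0_iff by blast
  then show ?thesis unfolding weight_def by (simp only: of_nat_0_less_iff)
qed

lemma L_eq: "L p = (\<Sum>i<N. \<Sum>j<N. poly p (b i \<bullet> b j))"
proof -
  let ?P = "{..<N} \<times> {..<N}" and ?g = "\<lambda>(i, j). b i \<bullet> b j"
  have "(\<Sum>i<N. \<Sum>j<N. poly p (b i \<bullet> b j)) = (\<Sum>z\<in>?P. poly p (?g z))"
    by (simp add: sum.cartesian_product case_prod_beta)
  also have "\<dots> = (\<Sum>s\<in>nodes. \<Sum>z | z \<in> ?P \<and> ?g z = s. poly p (?g z))"
    by (rule sum.group[symmetric]) (auto intro: inner_b_nodes)
  also have "\<dots> = (\<Sum>s\<in>nodes. weight s * poly p s)"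
  proof (intro sum.cong refl)
    fix s
    have "{z. z \<in> ?P \<and> ?g z = s} = {(i, j) \<in> {..<N} \<times> {..<N}. b i \<bullet> b j = s}" by auto
    moreover have "(\<Sum>z | z \<in> ?P \<and> ?g z = s. poly p (?g z)) = (\<Sum>z | z \<in> ?P \<and> ?g z = s. poly p s)"
      by (intro sum.cong) auto
    ultimately show "(\<Sum>z | z \<in> ?P \<and> ?g z = s. poly p (?g z)) = weight s * poly p s"
      by (simp add: weight_def)
  qed
  finally show ?thesis by (simp add: quad_def)
qed

section \<open>Convolution over the design: orthogonality and reproducing polynomials\<close>

lemma sum_inner_b:
  assumes "degree p \<le> 2 * m - 1" "norm x = 1"
  shows "real N * (\<Sum>j<N. poly p (x \<bullet> b j)) = L p"
proof -
  have "L p = (\<Sum>i<N. \<Sum>j<N. poly p (x \<bullet> b j))"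
    unfolding L_eq using assms by (intro sum.cong refl design_sum_const[OF design]) auto
  then show ?thesis by simp
qed

text \<open>The degrees add up to at most \<open>2 * m - 1\<close>, just within the strength. The
  convolution \<open>G\<close> has degree below \<open>k\<close>. The sum of its squares over the
  dot products from \<open>b i\<close> becomes, by associativity, a pairing of \<open>q\<close> with
  the lower degree polynomial \<open>H\<close>, hence 0; so \<open>G\<close> vanishes on all
  nodes.\<close>

lemma orth_poly_convolution:
  assumes q: "orth_poly nodes weight k q" and k: "k \<le> m" and r: "deg_lt k r"
    and x: "norm x = 1" and z: "norm z = 1"
  shows "(\<Sum>j<N. poly q (x \<bullet> b j) * poly r (z \<bullet> b j)) = 0"
proof (cases "r = 0")
  case False
  have degq: "degree q = k" using q by (simp add: orth_poly_def)
  have degr: "degree r < k" using r False by (simp add: deg_lt_iff)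
  have "degree q + degree r \<le> 2 * m - 1" using degq degr k by simp
  then obtain G where G: "degree G \<le> degree r"
    "\<And>x z. norm x = 1 \<Longrightarrow> norm z = 1 \<Longrightarrow>
      (\<Sum>j<N. poly q (x \<bullet> b j) * poly r (z \<bullet> b j)) = poly G (x \<bullet> z)"
    by (rule design_convolution[OF dim_ge_2 design]) blast
  have "degree r + degree G \<le> 2 * m - 1" using G(1) degr k by simp
  then obtain H where H: "degree H \<le> degree G"
    "\<And>x z. norm x = 1 \<Longrightarrow> norm z = 1 \<Longrightarrow>
      (\<Sum>j<N. poly r (x \<bullet> b j) * poly G (z \<bullet> b j)) = poly H (x \<bullet> z)"
    by (rule design_convolution[OF dim_ge_2 design]) blast
  have zero: "poly G (b i \<bullet> b j) = 0" if i: "i < N" and j: "j < N" for i j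
  proof -
    have nb: "norm (b i) = 1" using i by simp
    have "(\<Sum>k<N. (poly G (b i \<bullet> b k))\<^sup>2) =
        (\<Sum>k<N. \<Sum>l<N. poly q (b i \<bullet> b l) * poly r (b k \<bullet> b l) * poly G (b i \<bullet> b k))"
      using G(2)[OF nb] by (intro sum.cong) (simp_all add: power2_eq_square sum_distrib_right[symmetric])
    also have "\<dots> = (\<Sum>l<N. poly q (b i \<bullet> b l) * (\<Sum>k<N. poly r (b l \<bullet> b k) * poly G (b i \<bullet> b k)))"
      by (subst sum.swap) (simp add: sum_distrib_left mult.assoc inner_commute)
    also have "\<dots> = (\<Sum>l<N. poly (q * H) (b i \<bullet> b l))"
    proof (intro sum.cong refl)
      fix l assume "l \<in> {..<N}"
      then show "poly q (b i \<bullet> b l) * (\<Sum>k<N. poly r (b l \<bullet> b k) * poly G (b i \<bullet> b k)) =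
          poly (q * H) (b i \<bullet> b l)"
        using H(2)[of "b l" "b i"] nb inner_commute[of "b l" "b i"] by simp
    qed
    also have "real N * \<dots> = L (q * H)"
      using G(1) H(1) degq degr k degree_mult_le[of q H] by (intro sum_inner_b nb) linarith
    also have "L (q * H) = 0"
      using q G(1) H(1) degr by (simp add: orth_poly_def deg_lt_degree)
    finally have "(\<Sum>k<N. (poly G (b i \<bullet> b k))\<^sup>2) = 0" using N_pos by simp
    then have "\<forall>k\<in>{..<N}. (poly G (b i \<bullet> b k))\<^sup>2 = 0"
      by (subst (asm) sum_nonneg_eq_0_iff) auto
    then show ?thesis using j by simp
  qed
  have "G = 0"
  proof (rule ccontr)
    assume "G \<noteq> 0"
    have "deg_lt (card nodes) G" using G(1) degr k by (simp add: deg_lt_degree card_nodes)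
    then have "0 < L (G * G)"
      using quad_square_pos[OF finite_nodes, of weight G] weight_pos \<open>G \<noteq> 0\<close> by simp
    moreover have "L (G * G) = 0" unfolding L_eq by (simp add: zero)
    ultimately show False by simp
  qed
  then show ?thesis using G(2)[OF x z] by simp
qed simp

text \<open>The result has degree at most \<open>k\<close> and is orthogonal to lower degrees, so it
  is a multiple of \<open>q\<close>. The sign of the factor is read off at 1. The condition
  \<open>k < m\<close> keeps \<open>2 * k\<close> within the strength.\<close>

lemma orth_poly_self_convolution:
  assumes q: "orth_poly nodes weight k q" and k: "k < m"
  obtains c where "0 < c" "\<And>x z. norm x = 1 \<Longrightarrow> norm z = 1 \<Longrightarrow>
    (\<Sum>j<N. poly q (x \<bullet> b j) * poly q (z \<bullet> b j)) = c * poly q (x \<bullet> z)"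
proof -
  have degq: "degree q = k" and lead: "coeff q k = 1" using q by (auto simp: orth_poly_def)
  have "degree q + degree q \<le> 2 * m - 1" using degq k by simp
  then obtain G where G: "degree G \<le> degree q"
    "\<And>x z. norm x = 1 \<Longrightarrow> norm z = 1 \<Longrightarrow>
      (\<Sum>j<N. poly q (x \<bullet> b j) * poly q (z \<bullet> b j)) = poly G (x \<bullet> z)"
    by (rule design_convolution[OF dim_ge_2 design]) blast
  define c where "c = coeff G k"
  define R where "R = G - smult c q"
  have R: "deg_lt k R"
    unfolding deg_lt_def R_def c_def
  proof (intro allI impI)
    fix i assume "k \<le> i"
    then show "coeff (G - smult (coeff G k) q) i = 0"
      using G(1) degq lead by (cases "i = k") (simp_all add: coeff_eq_0)
  qed
  have orth: "L (G * p) = 0" if p: "deg_lt k p" for p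
  proof -
    have "(\<Sum>i<N. poly (G * p) (b l \<bullet> b i)) = 0" if l: "l < N" for l
    proof -
      have "(\<Sum>i<N. poly (G * p) (b l \<bullet> b i)) =
          (\<Sum>i<N. (\<Sum>j<N. poly q (b l \<bullet> b j) * poly q (b i \<bullet> b j)) * poly p (b l \<bullet> b i))"
        using G(2) l by (intro sum.cong) simp_all
      also have "\<dots> = (\<Sum>i<N. \<Sum>j<N. poly q (b l \<bullet> b j) * poly q (b i \<bullet> b j) * poly p (b l \<bullet> b i))"
        by (simp add: sum_distrib_right)
      also have "\<dots> = (\<Sum>j<N. poly q (b l \<bullet> b j) * (\<Sum>i<N. poly q (b j \<bullet> b i) * poly p (b l \<bullet> b i)))"
        by (subst sum.swap) (simp add: sum_distrib_left mult.assoc inner_commute)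
      also have "\<dots> = 0"
        using orth_poly_convolution[OF q _ p] k l by (intro sum.neutral) simp
      finally show ?thesis .
    qed
    then show ?thesis unfolding L_eq by simp
  qed
  have "L (q * R) = 0" using q R by (simp add: orth_poly_def)
  moreover have "L (G * R) = 0" using orth[OF R] .
  ultimately have "L (R * R) = 0"
    unfolding R_def by (simp add: left_diff_distrib quad_simps)
  then have "R = 0"
    using quad_square_pos[OF finite_nodes, of weight R] weight_pos deg_lt_mono[OF R, of "card nodes"] k
    by (force simp: card_nodes)
  then have Gq: "G = smult c q" by (simp add: R_def)
  have "0 < poly q 1"
  proof (rule orth_poly_pos_right[OF finite_nodes weight_pos _ q])
    show "s \<le> 1" if "s \<in> nodes" for s
      using that dots_range(2) by (auto simp: nodes_def less_imp_le)
  qed (use k in \<open>simp_all add: card_nodes\<close>)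
  moreover have "0 < c * poly q 1"
  proof -
    have nb: "norm (b 0) = 1" using N_pos by simp
    have "c * poly q 1 = (\<Sum>j<N. poly (q * q) (b 0 \<bullet> b j))"
      using G(2)[OF nb nb] nb N_pos by (simp add: Gq)
    also have "real N * \<dots> = L (q * q)"
      using degq k degree_mult_le[of q q] by (intro sum_inner_b nb) linarith
    also have "\<dots> > 0"
      using orth_poly_square_pos[OF finite_nodes weight_pos q] k by (simp add: card_nodes)
    finally show ?thesis using N_pos by (simp add: zero_less_mult_iff)
  qed
  ultimately have "0 < c" by (simp add: zero_less_mult_iff)
  then show thesis using that G(2) by (simp add: Gq)
qed

lemma orth_poly_nodes_exists: "k \<le> m \<Longrightarrow> \<exists>q. orth_poly nodes weight k q"
  using orth_poly_exists[where S = nodes and w = weight and n = k] weight_pos by (simp add: card_nodes)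

text \<open>\<open>K\<close> sums \<open>q / c\<close> over the orthogonal polynomials
  \<open>q\<close> of degree below \<open>k\<close>, with \<open>c\<close> the factor of the
  self-convolution; mixed terms vanish by orthogonality.\<close>

lemma reproducing_poly:
  assumes "k \<le> m"
  shows "\<exists>K. deg_lt k K \<and> (\<forall>p x z. deg_lt k p \<longrightarrow> norm x = 1 \<longrightarrow> norm z = 1 \<longrightarrow>
    (\<Sum>j<N. poly K (x \<bullet> b j) * poly p (z \<bullet> b j)) = poly p (x \<bullet> z))"
  using assms
proof (induction k)
  case 0
  then show ?case by (intro exI[of _ 0]) (auto simp: deg_lt_iff)
next
  case (Suc k)
  then obtain K where K: "deg_lt k K" "\<And>p x z. deg_lt k p \<Longrightarrow> norm x = 1 \<Longrightarrow> norm z = 1 \<Longrightarrow>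
    (\<Sum>j<N. poly K (x \<bullet> b j) * poly p (z \<bullet> b j)) = poly p (x \<bullet> z)" by auto
  obtain q where q: "orth_poly nodes weight k q"
    using orth_poly_nodes_exists[of k] Suc.prems by auto
  have degq: "degree q = k" and lead: "coeff q k = 1" using q by (auto simp: orth_poly_def)
  obtain c where c: "0 < c" "\<And>x z. norm x = 1 \<Longrightarrow> norm z = 1 \<Longrightarrow>
    (\<Sum>j<N. poly q (x \<bullet> b j) * poly q (z \<bullet> b j)) = c * poly q (x \<bullet> z)"
    using orth_poly_self_convolution[OF q] Suc.prems by auto
  define K' where "K' = K + smult (1 / c) q"
  have "deg_lt (Suc k) K'"
    unfolding K'_def using K(1) degq
    by (intro deg_lt_add deg_lt_smult) (auto intro: deg_lt_mono deg_lt_degree)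
  moreover have "(\<Sum>j<N. poly K' (x \<bullet> b j) * poly p (z \<bullet> b j)) = poly p (x \<bullet> z)"
    if p: "deg_lt (Suc k) p" and x: "norm x = 1" and z: "norm z = 1" for p x z
  proof -
    define a where "a = coeff p k"
    define r where "r = p - smult a q"
    have r: "deg_lt k r"
      unfolding deg_lt_def r_def a_def
    proof (intro allI impI)
      fix i assume "k \<le> i"
      then show "coeff (p - smult (coeff p k) q) i = 0"
        using degq lead deg_ltD[OF p, of i] by (cases "i = k") (simp_all add: coeff_eq_0)
    qed
    have p_eq: "p = r + smult a q" by (simp add: r_def)
    have "(\<Sum>j<N. poly K' (x \<bullet> b j) * poly p (z \<bullet> b j)) =
        (\<Sum>j<N. poly K (x \<bullet> b j) * poly r (z \<bullet> b j))
        + a * (\<Sum>j<N. poly q (z \<bullet> b j) * poly K (x \<bullet> b j))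
        + (1 / c) * (\<Sum>j<N. poly q (x \<bullet> b j) * poly r (z \<bullet> b j))
        + (a / c) * (\<Sum>j<N. poly q (x \<bullet> b j) * poly q (z \<bullet> b j))"
      unfolding p_eq K'_def sum_distrib_left sum.distrib[symmetric]
      by (intro sum.cong) (simp_all add: algebra_simps)
    also have "\<dots> = poly r (x \<bullet> z) + a * poly q (x \<bullet> z)"
      using K(2)[OF r x z] orth_poly_convolution[OF q _ K(1) z x] orth_poly_convolution[OF q _ r x z]
        c(2)[OF x z] c(1) Suc.prems by simp
    finally show ?thesis by (simp add: p_eq)
  qed
  ultimately show ?case by blast
qed

text \<open>With the reproducing polynomial \<open>K\<close> of degree below \<open>k\<close>, the measure
  \<open>\<delta>_x - (\<Sum>j. K(x \<bullet> b j) \<delta>_(b j))\<close> annihilates polynomials of degree below \<open>k\<close>, hence does not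
  distinguish the orthogonal polynomial \<open>q\<close> from the positive definite kernel \<open>(x \<bullet> z)^k\<close>.\<close>

lemma pd_orth_poly:
  assumes q: "orth_poly nodes weight k q" and k: "k \<le> m"
  shows "pd_poly TYPE('n) q"
proof -
  obtain K where K: "deg_lt k K" "\<And>p x z. deg_lt k p \<Longrightarrow> norm x = 1 \<Longrightarrow> norm z = 1 \<Longrightarrow>
    (\<Sum>j<N. poly K (x \<bullet> b j) * poly p (z \<bullet> b j)) = poly p (x \<bullet> z)"
    using reproducing_poly[OF k] by blast
  define E where "E F x z = F x z - (\<Sum>i<N. poly K (x \<bullet> b i) * F (b i) z)
    - (\<Sum>j<N. poly K (z \<bullet> b j) * F x (b j))
    + (\<Sum>i<N. \<Sum>j<N. poly K (x \<bullet> b i) * poly K (z \<bullet> b j) * F (b i) (b j))"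
    for F :: "real^'n \<Rightarrow> real^'n \<Rightarrow> real" and x z
  have E_diff: "E (\<lambda>x z. F x z - F' x z) x z = E F x z - E F' x z" for F F' x z
    unfolding E_def by (simp add: right_diff_distrib sum_subtractf)
  have Eq: "E (\<lambda>x z. poly q (x \<bullet> z)) x z = poly q (x \<bullet> z)" if x: "norm x = 1" and z: "norm z = 1" for x z
  proof -
    have 1: "(\<Sum>i<N. poly K (x \<bullet> b i) * poly q (b i \<bullet> z)) = 0" if "norm x = 1" "norm z = 1" for x z
      using orth_poly_convolution[OF q k K(1) that(2,1)] by (simp add: inner_commute mult.commute)
    have "(\<Sum>i<N. \<Sum>j<N. poly K (x \<bullet> b i) * poly K (z \<bullet> b j) * poly q (b i \<bullet> b j)) =
        (\<Sum>i<N. poly K (x \<bullet> b i) * (\<Sum>j<N. poly K (z \<bullet> b j) * poly q (b j \<bullet> b i)))"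
      by (simp add: sum_distrib_left mult.assoc inner_commute)
    also have "\<dots> = 0" using 1 z by simp
    finally show ?thesis
      unfolding E_def using 1[OF x z] 1[OF z x] by (simp add: inner_commute)
  qed
  \<comment> \<open>The reproducing property turns every correction term into the value itself, and
    1 - 1 - 1 + 1 = 0. For \<open>q\<close> above, the correction terms vanish instead.\<close>
  have Elow: "E (\<lambda>x z. poly p (x \<bullet> z)) x z = 0"
    if p: "deg_lt k p" and x: "norm x = 1" and z: "norm z = 1" for p x z
  proof -
    have 1: "(\<Sum>i<N. poly K (x \<bullet> b i) * poly p (b i \<bullet> z)) = poly p (x \<bullet> z)"
      if "norm x = 1" "norm z = 1" for x z
      using K(2)[OF p that] by (simp add: inner_commute)
    have "(\<Sum>i<N. \<Sum>j<N. poly K (x \<bullet> b i) * poly K (z \<bullet> b j) * poly p (b i \<bullet> b j)) =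
        (\<Sum>i<N. poly K (x \<bullet> b i) * (\<Sum>j<N. poly K (z \<bullet> b j) * poly p (b j \<bullet> b i)))"
      by (simp add: sum_distrib_left mult.assoc inner_commute)
    also have "\<dots> = (\<Sum>i<N. poly K (x \<bullet> b i) * poly p (b i \<bullet> z))"
      using 1 z by (intro sum.cong) (simp_all add: inner_commute)
    finally show ?thesis
      unfolding E_def using 1[OF x z] 1[OF z x] by (simp add: inner_commute)
  qed
  have "pd_kernel (E (\<lambda>x z. (x \<bullet> z) ^ k))"
    unfolding E_def by (rule pd_kernel_compress[OF pd_kernel_inner_power])
  then show ?thesis
  proof (rule pd_polyI)
    fix x z :: "real^'n" assume xz: "norm x = 1" "norm z = 1"
    have "deg_lt k (q - monom 1 k)"
      using q by (intro deg_lt_monic_diff) (auto simp: orth_poly_def degree_monom_eq)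
    then have "E (\<lambda>x z. poly q (x \<bullet> z) - (x \<bullet> z) ^ k) x z = 0"
      using Elow[of "q - monom 1 k", OF _ xz] by (simp add: poly_monom)
    then show "E (\<lambda>x z. (x \<bullet> z) ^ k) x z = poly q (x \<bullet> z)"
      unfolding E_diff Eq[OF xz] by simp
  qed
qed

text \<open>Nonnegative coefficients come from \<open>A\<close> being a prefix of
  \<open>nodes\<close>, and positive definite basis polynomials from \<open>pd_orth_poly\<close>. As
  \<open>A\<close> omits 1, its degree is at most \<open>m\<close>.\<close>

lemma pd_root_poly:
  assumes A: "A \<subseteq> dots" "\<And>s t. s \<in> A \<Longrightarrow> t \<in> dots - A \<Longrightarrow> s < t"
  shows "pd_poly TYPE('n) (root_poly A)"
proof -
  have "A \<subset> nodes" using A(1) one_notin_dots by (auto simp: nodes_def)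
  have less: "s < t" if "s \<in> A" "t \<in> nodes - A" for s t
    using that A dots_range(2) by (auto simp: nodes_def)
  have "\<exists>q. orth_poly nodes weight k q" if "k < card nodes" for k
    using that orth_poly_nodes_exists by (simp add: card_nodes)
  then obtain q where q: "\<And>k. k < card nodes \<Longrightarrow> orth_poly nodes weight k (q k)" by metis
  have "card A < card nodes" using \<open>A \<subset> nodes\<close> by (intro psubset_card_mono) auto
  then have "root_poly A = (\<Sum>i<card nodes. smult (L (root_poly A * q i) / L (q i * q i)) (q i))"
    using q by (intro orth_poly_expand[OF finite_nodes weight_pos]) (auto simp: deg_lt_degree)
  moreover have "pd_poly TYPE('n) (\<Sum>i<card nodes. smult (L (root_poly A * q i) / L (q i * q i)) (q i))"
  proof (rule pd_poly_sum)
    fix i assume "i \<in> {..<card nodes}"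
    then have i: "i < card nodes" by simp
    have "0 \<le> L (root_poly A * q i)"
      by (rule quad_root_poly_orth_poly_nonneg[OF finite_nodes weight_pos \<open>A \<subset> nodes\<close> less q[OF i] i])
    moreover have "0 < L (q i * q i)"
      by (rule orth_poly_square_pos[OF finite_nodes weight_pos q[OF i] i])
    ultimately show "0 \<le> L (root_poly A * q i) / L (q i * q i)" by simp
    show "pd_poly TYPE('n) (q i)"
      using pd_orth_poly[OF q[OF i]] i by (simp add: card_nodes)
  qed simp
  ultimately show ?thesis by simp
qed

section \<open>Polynomial energies compared with the sharp configuration\<close>

definition gap :: "(nat \<Rightarrow> real^'n) \<Rightarrow> real poly \<Rightarrow> real" where
  "gap x p = (\<Sum>i<N. \<Sum>j<N. poly p (x i \<bullet> x j)) - L p"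

text \<open>Each cross sum equals \<open>L p\<close> because \<open>b\<close> is a design. The gap
  is therefore the quadratic form of the signed measure that counts the points of \<open>x\<close>
  minus those of \<open>b\<close>.\<close>

lemma gap_eq:
  assumes x: "on_sphere N x" and p: "degree p \<le> 2 * m - 1"
  shows "gap x p = (\<Sum>i<N. \<Sum>j<N. poly p (x i \<bullet> x j)) - (\<Sum>i<N. \<Sum>j<N. poly p (x i \<bullet> b j))
    - (\<Sum>i<N. \<Sum>j<N. poly p (b i \<bullet> x j)) + (\<Sum>i<N. \<Sum>j<N. poly p (b i \<bullet> b j))"
proof -
  have nx: "norm (x i) = 1" if "i < N" for i using x that by (simp add: on_sphere_def)
  have "(\<Sum>j<N. poly p (x i \<bullet> b j)) = L p / N" if "i < N" for i
    using sum_inner_b[OF p nx[OF that]] N_pos by (simp add: field_simps)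
  then have 1: "(\<Sum>i<N. \<Sum>j<N. poly p (x i \<bullet> b j)) = L p" using N_pos by simp
  have "(\<Sum>i<N. \<Sum>j<N. poly p (b i \<bullet> x j)) = (\<Sum>i<N. \<Sum>j<N. poly p (x i \<bullet> b j))"
    by (subst sum.swap) (simp add: inner_commute)
  then show ?thesis using 1 by (simp add: gap_def L_eq)
qed

lemma gap_nonneg:
  assumes x: "on_sphere N x" and p: "degree p \<le> 2 * m - 1" and pd: "pd_poly TYPE('n) p"
  shows "0 \<le> gap x p"
proof -
  obtain K :: "real^'n \<Rightarrow> real^'n \<Rightarrow> real" where K: "pd_kernel K"
    "\<And>x y. norm x = 1 \<Longrightarrow> norm y = 1 \<Longrightarrow> K x y = poly p (x \<bullet> y)"
    using pd unfolding pd_poly_def by blast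
  have nx: "norm (x i) = 1" if "i < N" for i using x that by (simp add: on_sphere_def)
  show ?thesis
    using pd_kernel_signed_sum_nonneg[OF K(1), of x "{..<N}" b "{..<N}"]
    unfolding gap_eq[OF x p] by (simp add: K(2) nx)
qed

lemma gap_sum: "gap x (\<Sum>i\<in>I. smult (c i) (p i)) = (\<Sum>i\<in>I. c i * gap x (p i))"
proof -
  have "(\<Sum>i<N. \<Sum>j<N. poly (\<Sum>k\<in>I. smult (c k) (p k)) (x i \<bullet> x j)) =
      (\<Sum>k\<in>I. c k * (\<Sum>i<N. \<Sum>j<N. poly (p k) (x i \<bullet> x j)))"
    by (simp add: poly_sum sum_distrib_left sum.swap[of _ I])
  then show ?thesis
    unfolding gap_def by (simp add: quad_sum quad_simps right_diff_distrib sum_subtractf)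
qed

lemma gap_coeffs: "gap x p = (\<Sum>i\<le>degree p. coeff p i * gap x (monom 1 i))"
  using gap_sum[of x "\<lambda>i. coeff p i" "\<lambda>i. monom 1 i" "{..degree p}"]
  by (simp add: smult_monom poly_as_sum_of_monoms)

text \<open>A vanishing gap thus means that all moments of degree \<open>k\<close> agree with those
  of \<open>b\<close>, from which \<open>x\<close> inherits the design property.\<close>

lemma gap_monom:
  assumes x: "on_sphere N x" and k: "k \<le> 2 * m - 1"
  shows "gap x (monom 1 k) =
    (\<Sum>l | length l = k. ((\<Sum>i<N. mono_fun l (x i)) - (\<Sum>i<N. mono_fun l (b i)))\<^sup>2)"
proof -
  have sw: "(\<Sum>i<N. \<Sum>j<N. (y i \<bullet> z j) ^ k) =
      (\<Sum>l | length l = k. (\<Sum>i<N. mono_fun l (y i)) * (\<Sum>i<N. mono_fun l (z i)))"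
    for y z :: "nat \<Rightarrow> real^'n"
    unfolding inner_power_mono_fun sum_product
    by (simp add: sum.swap[of _ "{l. length l = k}"])
  have "degree (monom (1::real) k) \<le> 2 * m - 1" using k by (simp add: degree_monom_eq)
  from gap_eq[OF x this] show ?thesis
    by (simp only: poly_monom mult_1 sw power2_eq_square left_diff_distrib right_diff_distrib
        sum_subtractf)
qed

lemma design_if_gap_zero:
  assumes x: "on_sphere N x" and gap: "\<And>k. k \<le> 2 * m - 1 \<Longrightarrow> gap x (monom 1 k) = 0"
  shows "spherical_design N x (2 * m - 1)"
  unfolding spherical_design_def
proof (intro conjI allI impI x)
  fix p :: "real^'n \<Rightarrow> real" assume p: "poly_fun_deg_le (2 * m - 1) p"
  have mono: "(\<Sum>i<N. mono_fun l (x i)) = (\<Sum>i<N. mono_fun l (b i))" if "length l \<le> 2 * m - 1" for l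
  proof -
    have "(\<Sum>l' | length l' = length l. ((\<Sum>i<N. mono_fun l' (x i)) - (\<Sum>i<N. mono_fun l' (b i)))\<^sup>2) = 0"
      using gap_monom[OF x that] gap[OF that] by simp
    then have "\<forall>l'\<in>{l'. length l' = length l}. ((\<Sum>i<N. mono_fun l' (x i)) - (\<Sum>i<N. mono_fun l' (b i)))\<^sup>2 = 0"
      by (subst (asm) sum_nonneg_eq_0_iff) auto
    then show ?thesis by simp
  qed
  obtain c where c: "p = (\<lambda>x. \<Sum>\<alpha>\<in>{\<alpha>. sum \<alpha> UNIV \<le> 2 * m - 1}. c \<alpha> * (\<Prod>i\<in>UNIV. (x $ i) ^ \<alpha> i))"
    using p unfolding poly_fun_deg_le_def by blast
  have "(\<Sum>j<N. \<Prod>i\<in>UNIV. (x j $ i) ^ \<alpha> i) = (\<Sum>j<N. \<Prod>i\<in>UNIV. (b j $ i) ^ \<alpha> i)"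
    if \<alpha>: "sum \<alpha> UNIV \<le> 2 * m - 1" for \<alpha> :: "'n \<Rightarrow> nat"
  proof -
    obtain l where l: "length l = sum \<alpha> UNIV" "\<And>x :: real^'n. mono_fun l x = (\<Prod>i\<in>UNIV. (x $ i) ^ \<alpha> i)"
      using mono_fun_of_exponents[of \<alpha>] by metis
    with mono[of l] \<alpha> show ?thesis by simp
  qed
  then have "(\<Sum>j<N. p (x j)) = (\<Sum>j<N. p (b j))"
    unfolding c by (subst (1 2) sum.swap) (simp add: sum_distrib_left[symmetric])
  moreover have "(1 / real N) * (\<Sum>j<N. p (b j)) = integral\<^sup>L sphere_measure p"
    using design p unfolding spherical_design_def by blast
  ultimately show "(1 / real N) * (\<Sum>j<N. p (x j)) = integral\<^sup>L sphere_measure p" by simp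
qed

end

section \<open>Hermite interpolation at the dot products\<close>

lemma node_poly_Suc: "node_poly a (Suc n) = node_poly a n * [:- a n, 1:]"
  by (simp add: node_poly_def)

text \<open>A prefix of \<open>t 0, t 0, t 1, t 1, ...\<close> splits into two prefixes of the
  simple nodes; this carries positive definiteness over to the Newton polynomials.\<close>

lemma node_poly_double:
  "node_poly (\<lambda>i. t (i div 2)) k = node_poly t (k div 2) * node_poly t (Suc k div 2)"
proof (induction k)
  case (Suc k)
  have "Suc (Suc k) div 2 = Suc (k div 2)" by simp
  then show ?case
    by (simp only: node_poly_Suc Suc mult_ac)
qed (simp add: node_poly_def)

lemma node_poly_shift:
  "node_poly a (Suc n) = [:- a 0, 1:] * node_poly (\<lambda>i. a (Suc i)) n"
  unfolding node_poly_def by (simp only: prod.lessThan_Suc_shift)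

context sharp_configuration
begin

definition dot :: "nat \<Rightarrow> real" where "dot i = sorted_list_of_set dots ! i"

lemma dot_mono: "i < j \<Longrightarrow> j < m \<Longrightarrow> dot i < dot j"
  using strict_sorted_list_of_set[of dots] card_dots
  by (simp add: dot_def sorted_wrt_iff_nth_less)

lemma dot_image: "dot ` {..<m} = dots"
proof -
  have "dots = set (sorted_list_of_set dots)" by simp
  also have "\<dots> = (\<lambda>i. sorted_list_of_set dots ! i) ` {..<m}"
    using card_dots by (auto simp: set_conv_nth)
  finally show ?thesis by (simp add: dot_def[abs_def])
qed

lemma dot_in_dots: "i < m \<Longrightarrow> dot i \<in> dots"
  using dot_image by blast

lemma dot_range: "i < m \<Longrightarrow> dot i \<in> {-1..<1}"
  using dot_in_dots dots_range by auto

lemma inj_on_dot: "inj_on dot {..<m}"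
  by (rule inj_onI) (metis dot_mono lessThan_iff linorder_neqE_nat order_less_irrefl)

lemma pd_node_poly_dot:
  assumes "k \<le> m"
  shows "pd_poly TYPE('n) (node_poly dot k)"
proof -
  have "node_poly dot k = root_poly (dot ` {..<k})"
    unfolding node_poly_def root_poly_def
    using assms by (subst prod.reindex) (auto intro: inj_on_subset[OF inj_on_dot])
  moreover have "pd_poly TYPE('n) (root_poly (dot ` {..<k}))"
  proof (rule pd_root_poly)
    show "dot ` {..<k} \<subseteq> dots" using assms dot_in_dots by auto
    fix s t assume "s \<in> dot ` {..<k}" "t \<in> dots - dot ` {..<k}"
    then obtain i j where "s = dot i" "i < k" "t = dot j" "j < m" "\<not> j < k"
      using dot_image by blast
    then show "s < t" by (auto intro: dot_mono)
  qed
  ultimately show ?thesis by simp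
qed

abbreviation dnode :: "nat \<Rightarrow> real" where "dnode i \<equiv> dot (i div 2)"

lemma pd_node_poly_dnode:
  assumes "k < 2 * m"
  shows "pd_poly TYPE('n) (node_poly dnode k)"
  unfolding node_poly_double using assms by (intro pd_poly_mult pd_node_poly_dot) auto

lemma dnode_range: "i < 2 * m \<Longrightarrow> dnode i \<in> {-1..<1}"
  by (intro dot_range) auto

lemma poly_node_poly_dnode: "poly (node_poly dnode (2 * m)) s = (poly (node_poly dot m) s)\<^sup>2"
  by (simp add: node_poly_double power2_eq_square)

lemma poly_node_poly_dot_eq_0_iff: "poly (node_poly dot m) s = 0 \<longleftrightarrow> s \<in> dots"
  using dot_image by (auto simp: poly_node_poly)

lemma newton_below:
  assumes D: "abs_mono D" and g: "continuous_on {-1..1} g" "\<And>t. t \<in> {-1..<1} \<Longrightarrow> g t = D 0 t"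
    and s: "s \<in> {-1..1}"
  shows "poly (newton_poly dnode D (2 * m)) s \<le> g s"
    and "s \<in> dots \<Longrightarrow> g s = poly (newton_poly dnode D (2 * m)) s"
    and "strict_abs_mono D \<Longrightarrow> s \<notin> dots \<Longrightarrow> poly (newton_poly dnode D (2 * m)) s < g s"
proof -
  let ?H = "poly (newton_poly dnode D (2 * m))" and ?R = "iter_diff_quot dnode D (2 * m) 0"
  obtain c where c: "g 1 = ?H 1 + poly (node_poly dnode (2 * m)) 1 * c"
    "\<And>t. t \<in> {-1..<1} \<Longrightarrow> ?R t \<le> c"
    using newton_endpoint[where a = dnode and n = "2 * m", OF D dnode_range g] by blast
  \<comment> \<open>The remainder is controlled below 1 only; at 1 the constant \<open>c\<close>
    takes over. It is nonnegative since it bounds the remainder at 0.\<close>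
  define r where "r = (if s = 1 then c else ?R s)"
  have eq: "g s = ?H s + (poly (node_poly dot m) s)\<^sup>2 * r"
    using c(1) newton_expansion[where a = dnode and n = "2 * m" and t = s, OF D dnode_range] g(2)[of s] s
    by (auto simp: r_def poly_node_poly_dnode)
  have "0 \<le> ?R t" if "t \<in> {-1..<1}" for t
    using iter_diff_quot_nonneg[where a = dnode and n = "2 * m", OF D dnode_range _ that] m_ge_1 by simp
  then have "0 \<le> r" using c(2)[of 0] s order_trans[of 0 "?R 0" c] by (auto simp: r_def)
  then show "?H s \<le> g s" unfolding eq by simp
  show "g s = ?H s" if "s \<in> dots" using that eq by (simp add: poly_node_poly_dot_eq_0_iff)
  show "?H s < g s" if strict: "strict_abs_mono D" and nin: "s \<notin> dots"
  proof -
    have last: "dnode (2 * m - 1) \<in> dots" using m_ge_1 by (intro dot_in_dots) auto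
    have pos: "0 < ?R t" if "t \<in> {-1..<1}" "dnode (2 * m - 1) \<noteq> t" for t
      using iter_diff_quot_pos[where a = dnode and n = "2 * m", OF strict dnode_range _ that(1)] that(2) m_ge_1
      by auto
    have "0 < r"
    proof (cases "s = 1")
      case True
      \<comment> \<open>Any point other than the last node serves: the two are then not both
        \<open>-1\<close>, as \<open>iter_diff_quot_pos\<close> demands.\<close>
      define t where "t = (if dnode (2 * m - 1) = 0 then 1/2 else 0 :: real)"
      have t: "t \<in> {-1..<1}" "dnode (2 * m - 1) \<noteq> t" by (auto simp: t_def)
      show ?thesis using pos[OF t] c(2)[OF t(1)] True by (simp add: r_def)
    next
      case False
      then show ?thesis using pos[of s] s last nin by (auto simp: r_def)
    qed
    moreover have "0 < (poly (node_poly dot m) s)\<^sup>2"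
      using nin by (simp add: poly_node_poly_dot_eq_0_iff)
    ultimately show ?thesis unfolding eq by simp
  qed
qed

section \<open>Energy minimality and the case of equality\<close>

definition energy :: "(real \<Rightarrow> real) \<Rightarrow> (nat \<Rightarrow> real^'n) \<Rightarrow> real" where
  "energy g x = (\<Sum>i<N. \<Sum>j<N. g (x i \<bullet> x j))"

lemma inner_range:
  fixes x y :: "real^'n"
  assumes "norm x = 1" "norm y = 1"
  shows "x \<bullet> y \<in> {-1..1}"
  using Cauchy_Schwarz_ineq2[of x y] assms by auto

text \<open>The diagonal contributes the same to both configurations and cancels, so
  \<open>H\<close> need not interpolate at 1. Off the diagonal \<open>H\<close> agrees with
  \<open>g\<close> on the dot products of \<open>b\<close>.\<close>

lemma energy_diff:
  assumes D: "abs_mono D" and g: "continuous_on {-1..1} g" "\<And>t. t \<in> {-1..<1} \<Longrightarrow> g t = D 0 t"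
    and x: "on_sphere N x"
  defines "H \<equiv> newton_poly dnode D (2 * m)"
  shows "energy g x - energy g b =
    (\<Sum>i<N. \<Sum>j<N. if i = j then 0 else g (x i \<bullet> x j) - poly H (x i \<bullet> x j)) +
    (\<Sum>k<2 * m. iter_diff_quot dnode D k 0 (dnode k) * gap x (node_poly dnode k))"
proof -
  have split: "energy g y = (\<Sum>i<N. \<Sum>j<N. if i = j then 0 else g (y i \<bullet> y j) - poly H (y i \<bullet> y j)) +
      (\<Sum>i<N. \<Sum>j<N. poly H (y i \<bullet> y j)) + real N * (g 1 - poly H 1)"
    if y: "on_sphere N y" for y
  proof -
    have "y i \<bullet> y i = 1" if "i < N" for i
      using y that by (simp add: on_sphere_def norm_eq_1)
    then have "energy g y = (\<Sum>i<N. \<Sum>j<N. (if i = j then 0 else g (y i \<bullet> y j) - poly H (y i \<bullet> y j)) +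
        poly H (y i \<bullet> y j) + (if i = j then g 1 - poly H 1 else 0))"
      unfolding energy_def by (intro sum.cong) auto
    then show ?thesis by (simp add: sum.distrib)
  qed
  have "g (b i \<bullet> b j) = poly H (b i \<bullet> b j)" if "i < N" "j < N" "i \<noteq> j" for i j
  proof -
    have "b i \<bullet> b j \<in> dots" using that by (auto simp: dots_def dot_products_def)
    then show ?thesis
      unfolding H_def using newton_below(2)[OF D g, of "b i \<bullet> b j"] dots_range[of "b i \<bullet> b j"] by simp
  qed
  then have "(\<Sum>i<N. \<Sum>j<N. if i = j then 0 else g (b i \<bullet> b j) - poly H (b i \<bullet> b j)) = 0"
    by (intro sum.neutral ballI) auto
  moreover have "on_sphere N b" by (simp add: on_sphere_def)
  ultimately have "energy g x - energy g b =
    (\<Sum>i<N. \<Sum>j<N. if i = j then 0 else g (x i \<bullet> x j) - poly H (x i \<bullet> x j)) + gap x H"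
    using split[OF x] split[of b] by (simp add: gap_def L_eq)
  then show ?thesis
    by (simp add: H_def newton_poly_def gap_sum)
qed

text \<open>This absorbs the zeroth Newton coefficient, the only one without a sign.\<close>

lemma gap_0: "gap x (node_poly a 0) = 0"
  by (simp add: gap_def L_eq node_poly_def)

lemma energy_terms_nonneg:
  assumes D: "abs_mono D" and x: "on_sphere N x" and k: "k < 2 * m"
  shows "0 \<le> iter_diff_quot dnode D k 0 (dnode k) * gap x (node_poly dnode k)"
proof (cases "k = 0")
  case False
  have "0 \<le> iter_diff_quot dnode D k 0 (dnode k)"
    by (rule iter_diff_quot_nonneg[OF D dnode_range _ dnode_range]) (use k False in auto)
  moreover have "0 \<le> gap x (node_poly dnode k)"
    using k by (intro gap_nonneg x pd_node_poly_dnode) auto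
  ultimately show ?thesis by simp
qed (simp only: gap_0 mult_zero_right order_refl)

lemma energy_pairs_nonneg:
  fixes x :: "nat \<Rightarrow> real^'n"
  assumes D: "abs_mono D" and g: "continuous_on {-1..1} g" "\<And>t. t \<in> {-1..<1} \<Longrightarrow> g t = D 0 t"
    and x: "on_sphere N x" and "i < N" "j < N"
  shows "0 \<le> (if i = j then 0 else g (x i \<bullet> x j) - poly (newton_poly dnode D (2 * m)) (x i \<bullet> x j))"
  using newton_below(1)[OF D g inner_range[of "x i" "x j"]] assms(4-6) by (simp add: on_sphere_def)

lemma energy_minimal:
  assumes "abs_mono D" "continuous_on {-1..1} g" "\<And>t. t \<in> {-1..<1} \<Longrightarrow> g t = D 0 t" "on_sphere N x"
  shows "energy g b \<le> energy g x"
proof -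
  have "0 \<le> (\<Sum>i<N. \<Sum>j<N. if i = j then 0 else
      g (x i \<bullet> x j) - poly (newton_poly dnode D (2 * m)) (x i \<bullet> x j))"
    by (intro sum_nonneg energy_pairs_nonneg[OF assms]) auto
  moreover have "0 \<le> (\<Sum>k<2 * m. iter_diff_quot dnode D k 0 (dnode k) * gap x (node_poly dnode k))"
    by (intro sum_nonneg energy_terms_nonneg[OF assms(1,4)]) auto
  ultimately show ?thesis using energy_diff[OF assms] by linarith
qed

lemma gap_node_poly:
  assumes "\<And>i. i < k \<Longrightarrow> gap x (monom 1 i) = 0"
  shows "gap x (node_poly a k) = gap x (monom 1 k)"
proof -
  have "gap x (node_poly a k) = (\<Sum>i\<le>k. coeff (node_poly a k) i * gap x (monom 1 i))"
    using gap_coeffs[of x "node_poly a k"] by simp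
  also have "\<dots> = (\<Sum>i\<in>{k}. coeff (node_poly a k) i * gap x (monom 1 i))"
    using assms by (intro sum.mono_neutral_right) auto
  also have "\<dots> = gap x (monom 1 k)"
    using lead_coeff_node_poly[of a k] by simp
  finally show ?thesis .
qed

lemma energy_equality:
  assumes D: "strict_abs_mono D" and g: "continuous_on {-1..1} g" "\<And>t. t \<in> {-1..<1} \<Longrightarrow> g t = D 0 t"
    and x: "on_sphere N x" and eq: "energy g x = energy g b"
  shows "\<And>i j. i < N \<Longrightarrow> j < N \<Longrightarrow> i \<noteq> j \<Longrightarrow> x i \<bullet> x j \<in> dots"
    and "\<And>k. k \<le> 2 * m - 1 \<Longrightarrow> gap x (monom 1 k) = 0"
proof -
  let ?H = "poly (newton_poly dnode D (2 * m))"
  define F where "F i j = (if i = j then 0 else g (x i \<bullet> x j) - ?H (x i \<bullet> x j))" for i j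
  let ?c = "\<lambda>k. iter_diff_quot dnode D k 0 (dnode k)"
  have D': "abs_mono D" using D by (simp add: strict_abs_mono_def)
  have nx: "norm (x i) = 1" if "i < N" for i using x that by (simp add: on_sphere_def)
  have F: "0 \<le> F i j" if "i < N" "j < N" for i j
    unfolding F_def by (rule energy_pairs_nonneg[OF D' g x that])
  have "0 \<le> (\<Sum>i<N. \<Sum>j<N. F i j)" using F by (intro sum_nonneg) auto
  moreover have "0 \<le> (\<Sum>k<2 * m. ?c k * gap x (node_poly dnode k))"
    by (intro sum_nonneg energy_terms_nonneg[OF D' x]) auto
  ultimately have F0: "(\<Sum>i<N. \<Sum>j<N. F i j) = 0"
    and C0: "(\<Sum>k<2 * m. ?c k * gap x (node_poly dnode k)) = 0"
    using energy_diff[OF D' g x] eq unfolding F_def[symmetric] by linarith+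
  show in_dots: "x i \<bullet> x j \<in> dots" if "i < N" "j < N" "i \<noteq> j" for i j
  proof -
    have "\<forall>i\<in>{..<N}. (\<Sum>j<N. F i j) = 0"
      using F0 by (subst (asm) sum_nonneg_eq_0_iff) (auto intro!: sum_nonneg F)
    then have "(\<Sum>j<N. F i j) = 0" using that by blast
    then have "\<forall>j\<in>{..<N}. F i j = 0"
      using that by (subst (asm) sum_nonneg_eq_0_iff) (auto intro!: F)
    then have "F i j = 0" using that by blast
    then have "g (x i \<bullet> x j) = ?H (x i \<bullet> x j)" using that by (simp add: F_def)
    then show ?thesis
      using newton_below(3)[OF D' g inner_range[OF nx nx] D, of i j] that by force
  qed
  have "\<forall>k\<in>{..<2 * m}. ?c k * gap x (node_poly dnode k) = 0"
    using C0 by (subst (asm) sum_nonneg_eq_0_iff) (auto intro!: energy_terms_nonneg[OF D' x])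
  then have zero: "?c k = 0 \<or> gap x (node_poly dnode k) = 0" if "k < 2 * m" for k
    using that by simp
  \<comment> \<open>A coefficient can degenerate only if its last two nodes are both
    \<open>-1\<close>, that is, for \<open>k = 1\<close> and \<open>dot 0 = -1\<close>.\<close>
  have c_pos: "0 < ?c k" if "1 \<le> k" "k < 2 * m" "dnode (k - 1) \<noteq> -1 \<or> dnode k \<noteq> -1" for k
  proof (rule iter_diff_quot_pos[where a = dnode and n = k and t = "dnode k", OF D _ that(1) _ that(3)])
    show "dnode i \<in> {-1..<1}" if "i < k" for i using that \<open>k < 2 * m\<close> by (intro dnode_range) simp
    show "dnode k \<in> {-1..<1}" using \<open>k < 2 * m\<close> by (rule dnode_range)
  qed
  have gap0: "gap x (monom 1 0) = 0"
    by (simp add: gap_def L_eq poly_monom)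
  have nonneg: "0 \<le> gap x (monom 1 k)" if "k \<le> 2 * m - 1" for k
    using that by (intro gap_nonneg x pd_poly_monom) (simp add: degree_monom_eq)
  \<comment> \<open>The first Newton coefficient is \<open>g' (dot 0)\<close>, which may vanish if \<open>dot 0 = -1\<close>; then the
    first moment is read off the second Newton polynomial \<open>(t + 1)^2\<close>.\<close>
  have gap1: "gap x (monom 1 (Suc 0)) = 0"
  proof (cases "m = 1")
    case True
    have single: "t = dot 0" if "t \<in> dots" for t using that dot_image True by auto
    \<comment> \<open>For \<open>m = 1\<close> the degree of \<open>(t + 1)^2\<close> is out of
      reach, but there is a single dot product, so the Gram matrices coincide.\<close>
    have xi: "x i \<bullet> x j = b i \<bullet> b j" if "i < N" "j < N" for i j
    proof (cases "i = j")
      case True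
      then show ?thesis using nx that by (simp add: norm_eq_1)
    next
      case False
      have "b i \<bullet> b j \<in> dots" using that False by (auto simp: dots_def dot_products_def)
      then show ?thesis using in_dots[OF that False] single by metis
    qed
    show ?thesis unfolding gap_def L_eq by (simp add: xi)
  next
    case False
    then have m2: "2 \<le> m" using m_ge_1 by simp
    show ?thesis
    proof (cases "dot 0 = -1")
      case True
      have "dot 0 < dot 1" using m2 by (intro dot_mono) auto
      then have "0 < ?c 2" using c_pos[of 2] m2 True by auto
      then have "gap x (node_poly dnode 2) = 0" using zero[of 2] m2 by auto
      moreover have "gap x (node_poly dnode 2) =
          (\<Sum>i\<le>2. coeff (node_poly dnode 2) i * gap x (monom 1 i))"
        using gap_coeffs[of x "node_poly dnode 2"] by simp
      moreover have "node_poly dnode 2 = [:1, 2, 1:]"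
        using True by (simp add: node_poly_def numeral_2_eq_2)
      ultimately have "2 * gap x (monom 1 1) + gap x (monom 1 2) = 0"
        using gap0 by (simp add: numeral_2_eq_2)
      moreover have "0 \<le> gap x (monom 1 1)" "0 \<le> gap x (monom 1 2)"
        using m2 by (intro nonneg; simp)+
      ultimately show ?thesis by simp
    next
      case False
      then have "0 < ?c 1" using c_pos[of 1] m2 by simp
      then have "gap x (node_poly dnode 1) = 0" using zero[of 1] m2 by auto
      then show ?thesis using gap_node_poly[of 1 x dnode] gap0 by simp
    qed
  qed
  show "gap x (monom 1 k) = 0" if "k \<le> 2 * m - 1" for k
    using that
  proof (induction k rule: less_induct)
    case (less k)
    consider "k = 0" | "k = Suc 0" | "2 \<le> k" by linarith
    then show ?case
    proof cases
      case 3
      have k: "k < 2 * m" "k div 2 < m" using less.prems m_ge_1 by auto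
      have "dot 0 < dnode k" using 3 k by (intro dot_mono) auto
      moreover have "-1 \<le> dot 0" using dot_range[of 0] m_ge_1 by auto
      ultimately have "0 < ?c k" using c_pos[of k] 3 k(1) by auto
      then have "gap x (node_poly dnode k) = 0" using zero[OF k(1)] by auto
      then show ?thesis using gap_node_poly[of k x dnode] less by auto
    qed (use gap0 gap1 in auto)
  qed
qed

lemma sharp_if_gap_zero:
  assumes x: "on_sphere N x" and dots_x: "\<And>i j. i < N \<Longrightarrow> j < N \<Longrightarrow> i \<noteq> j \<Longrightarrow> x i \<bullet> x j \<in> dots"
    and gap: "\<And>k. k \<le> 2 * m - 1 \<Longrightarrow> gap x (monom 1 k) = 0"
  shows "m_sharp N x m" "dot_products N x = dots"
proof -
  have x1: "x i \<bullet> x i = 1" if "i < N" for i using x that by (simp add: on_sphere_def norm_eq_1)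
  have inj: "inj_on x {..<N}"
  proof (rule inj_onI, rule ccontr)
    fix i j assume "i \<in> {..<N}" "j \<in> {..<N}" "x i = x j" "i \<noteq> j"
    then show False using dots_x[of i j] x1[of j] one_notin_dots by simp
  qed
  let ?D = "dot_products N x"
  have sub: "?D \<subseteq> dots" using dots_x by (auto simp: dot_products_def)
  have finD: "finite ?D" using finite_subset[OF sub finite_dots] .
  show eq: "?D = dots"
  proof (rule ccontr)
    assume "?D \<noteq> dots"
    with sub obtain s where s: "s \<in> dots" "s \<notin> ?D" by blast
    \<comment> \<open>With \<open>s\<close> missing, \<open>x\<close> has at most
      \<open>m - 1\<close> dot products, so \<open>P\<close> has degree at most
      \<open>2 * m - 1\<close> and equal sums for \<open>x\<close> and \<open>b\<close>. It vanishes
      on all pairs of \<open>x\<close> but is nonnegative on the nodes and positive at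
      \<open>s\<close>.\<close>
    define P where "P = [:1, -1:] * (root_poly ?D * root_poly ?D)"
    have "card ?D < m" using psubset_card_mono[OF finite_dots, of ?D] sub s card_dots by auto
    moreover have "degree P \<le> 1 + (card ?D + card ?D)"
      unfolding P_def by (intro order_trans[OF degree_mult_le] add_mono) simp_all
    ultimately have degP: "degree P \<le> 2 * m - 1" by linarith
    have P0: "poly P (x i \<bullet> x j) = 0" if "i < N" "j < N" for i j
    proof (cases "i = j")
      case True
      then show ?thesis using x1 that by (simp add: P_def)
    next
      case False
      then have "x i \<bullet> x j \<in> ?D" using that by (auto simp: dot_products_def)
      then show ?thesis using finD by (auto simp: P_def poly_root_poly)
    qed
    have "gap x P = (\<Sum>i\<le>degree P. coeff P i * gap x (monom 1 i))"
      by (rule gap_coeffs)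
    also have "\<dots> = 0" using gap degP by (intro sum.neutral) auto
    finally have "L P = 0" using P0 by (simp add: gap_def)
    moreover have "0 < L P"
      unfolding quad_def
    proof (rule sum_pos2)
      show "s \<in> nodes" using s by (simp add: nodes_def)
      have "poly (root_poly ?D) s \<noteq> 0" using s finD by (simp add: poly_root_poly)
      then have "0 < poly P s"
        using dots_range(2)[OF s(1)] by (auto simp: P_def zero_less_mult_iff linorder_neq_iff)
      then show "0 < weight s * poly P s" using weight_pos[OF \<open>s \<in> nodes\<close>] by simp
      fix t assume t: "t \<in> nodes"
      then have "t \<le> 1" using dots_range(2) by (auto simp: nodes_def less_imp_le)
      moreover have "poly P t = (1 - t) * (poly (root_poly ?D) t)\<^sup>2"
        by (simp add: P_def power2_eq_square algebra_simps)
      ultimately have "0 \<le> poly P t" by simp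
      then show "0 \<le> weight t * poly P t" using weight_pos[OF t] by simp
    qed simp
    ultimately show False by simp
  qed
  show "m_sharp N x m"
    unfolding m_sharp_def using inj design_if_gap_zero[OF x gap] eq card_dots by simp
qed

section \<open>The potential of the sharp configuration\<close>

lemma potential_le_energy:
  assumes design': "spherical_design N b M" and p: "degree p \<le> M"
    and above: "\<And>s. s \<in> {-1..1} \<Longrightarrow> g s \<le> poly p s" and eq: "\<And>s. s \<in> nodes \<Longrightarrow> g s = poly p s"
    and y: "norm y = 1"
  shows "real N * (\<Sum>j<N. g (y \<bullet> b j)) \<le> energy g b"
proof -
  have "(\<Sum>j<N. g (y \<bullet> b j)) \<le> (\<Sum>j<N. poly p (y \<bullet> b j))"
    using above inner_range[OF y] by (intro sum_mono) auto
  then have "real N * (\<Sum>j<N. g (y \<bullet> b j)) \<le> (\<Sum>i<N. \<Sum>j<N. poly p (y \<bullet> b j))"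
    by (simp add: mult_left_mono)
  \<comment> \<open>The sum of \<open>p\<close> over the design is the same seen from
    \<open>y\<close> as from each \<open>b i\<close>, and from there only nodes occur.\<close>
  also have "\<dots> = (\<Sum>i<N. \<Sum>j<N. poly p (b i \<bullet> b j))"
    using y by (intro sum.cong refl design_sum_const[OF design' p]) auto
  also have "\<dots> = energy g b"
    unfolding energy_def using eq inner_b_nodes by (intro sum.cong refl) auto
  finally show ?thesis .
qed

text \<open>Replacing the remainder by its upper bound \<open>c\<close> gives a majorant that also
  interpolates at 1, at the cost of one degree.\<close>

lemma newton_above:
  assumes D: "abs_mono D" and g: "continuous_on {-1..1} g" "\<And>t. t \<in> {-1..<1} \<Longrightarrow> g t = D 0 t"
    and a: "\<And>i. i < n \<Longrightarrow> a i \<in> {-1..<1}"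
    and nonneg: "\<And>s. s \<in> {-1..1} \<Longrightarrow> 0 \<le> poly (node_poly a n) s"
    and zero: "\<And>s. s \<in> dots \<Longrightarrow> poly (node_poly a n) s = 0"
  obtains p where "degree p \<le> n" "\<And>s. s \<in> {-1..1} \<Longrightarrow> g s \<le> poly p s"
    "\<And>s. s \<in> nodes \<Longrightarrow> g s = poly p s"
proof -
  obtain c where c: "g 1 = poly (newton_poly a D n) 1 + poly (node_poly a n) 1 * c"
    "\<And>t. t \<in> {-1..<1} \<Longrightarrow> iter_diff_quot a D n 0 t \<le> c"
    using newton_endpoint[where a = a and n = n, OF D a g] by blast
  define p where "p = newton_poly a D n + smult c (node_poly a n)"
  have exp: "g s = poly (newton_poly a D n) s + poly (node_poly a n) s * iter_diff_quot a D n 0 s"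
    if "s \<in> {-1..<1}" for s
    using newton_expansion[where a = a and n = n, OF D a that] g(2)[OF that] by simp
  have g1: "g 1 = poly p 1" using c(1) by (simp add: p_def)
  show thesis
  proof (rule that)
    show "degree p \<le> n"
      unfolding p_def
      by (intro degree_add_le order_trans[OF degree_newton_poly] order_trans[OF degree_smult_le]) simp_all
    show "g s \<le> poly p s" if s: "s \<in> {-1..1}" for s
    proof (cases "s = 1")
      case False
      then have s': "s \<in> {-1..<1}" using s by auto
      show ?thesis
        using mult_left_mono[OF c(2)[OF s'] nonneg[OF s]] exp[OF s'] by (simp add: p_def mult.commute)
    qed (use g1 in simp)
    show "g s = poly p s" if "s \<in> nodes" for s
      using that g1 exp[of s] zero[of s] dots_range[of s] by (auto simp: nodes_def p_def)
  qed
qed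

lemma potential_bound:
  assumes sharp': "strongly_m_sharp N b m \<or> antipodal N b"
    and D: "abs_mono D" and g: "continuous_on {-1..1} g" "\<And>t. t \<in> {-1..<1} \<Longrightarrow> g t = D 0 t"
    and y: "norm y = 1"
  shows "real N * (\<Sum>j<N. g (y \<bullet> b j)) \<le> energy g b"
  using sharp'
proof
  assume "strongly_m_sharp N b m"
  then have design': "spherical_design N b (2 * m)" by (simp add: strongly_m_sharp_def)
  obtain p where "degree p \<le> 2 * m" "\<And>s. s \<in> {-1..1} \<Longrightarrow> g s \<le> poly p s"
    "\<And>s. s \<in> nodes \<Longrightarrow> g s = poly p s"
    using newton_above[where a = dnode and n = "2 * m", OF D g dnode_range]
    by (auto simp: poly_node_poly_dnode poly_node_poly_dot_eq_0_iff)
  then show ?thesis by (rule potential_le_energy[OF design' _ _ _ y])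
next
  assume anti: "antipodal N b"
  \<comment> \<open>The doubled sequence with one copy of its first node dropped; that node turns
    out to be \<open>-1\<close>.\<close>
  define a where "a i = dnode (Suc i)" for i
  obtain j where j: "j < N" "b j = - b 0" using anti N_pos unfolding antipodal_def by blast
  have b0j: "b 0 \<bullet> b j = -1" using j N_pos by simp
  then have "j \<noteq> 0" using inner_b_self[OF N_pos] by (intro notI) simp
  have "-1 \<in> dots" using b0j[symmetric] j N_pos \<open>j \<noteq> 0\<close> unfolding dots_def dot_products_def
    by (intro CollectI exI[of _ 0] exI[of _ j]) auto
  then obtain k where k: "k < m" "dot k = -1" using dot_image by (metis imageE lessThan_iff)
  have dot0: "dot 0 = -1"
    using dot_mono[of 0 k] dot_range[of 0] k m_ge_1 by (cases "k = 0") auto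
  have n: "Suc (2 * m - 1) = 2 * m" using m_ge_1 by simp
  have sq: "(s + 1) * poly (node_poly a (2 * m - 1)) s = (poly (node_poly dot m) s)\<^sup>2" for s
  proof -
    have "node_poly dnode (2 * m) = [:1, 1:] * node_poly a (2 * m - 1)"
      using node_poly_shift[of dnode "2 * m - 1"] unfolding n a_def by (simp add: dot0)
    then show ?thesis by (simp add: poly_node_poly_dnode[symmetric] algebra_simps)
  qed
  \<comment> \<open>The identity \<open>sq\<close> says nothing about this value, as its factor
    \<open>s + 1\<close> vanishes; the remaining copy of the node gives it.\<close>
  have at_m1: "poly (node_poly a (2 * m - 1)) (-1) = 0"
    unfolding poly_node_poly using m_ge_1 dot0 by (auto simp: a_def intro!: bexI[of _ 0])
  have "0 \<le> poly (node_poly a (2 * m - 1)) s" if s: "s \<in> {-1..1}" for s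
  proof (cases "s = -1")
    case False
    then have "0 < s + 1" using s by simp
    moreover have "0 \<le> (s + 1) * poly (node_poly a (2 * m - 1)) s" unfolding sq by simp
    ultimately show ?thesis by (simp add: zero_le_mult_iff)
  qed (simp only: at_m1 order_refl)
  moreover have "poly (node_poly a (2 * m - 1)) s = 0" if "s \<in> dots" for s
    using sq[of s] that at_m1 by (cases "s = -1") (auto simp: poly_node_poly_dot_eq_0_iff[symmetric])
  moreover have "a i \<in> {-1..<1}" if "i < 2 * m - 1" for i
    unfolding a_def using that by (intro dnode_range) auto
  ultimately obtain p where "degree p \<le> 2 * m - 1" "\<And>s. s \<in> {-1..1} \<Longrightarrow> g s \<le> poly p s"
    "\<And>s. s \<in> nodes \<Longrightarrow> g s = poly p s"
    using newton_above[where a = a and n = "2 * m - 1", OF D g] by blast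
  then show ?thesis by (rule potential_le_energy[OF design _ _ _ y])
qed

end

text \<open>For unit vectors \<open>|x - y|^2 = 2 - 2 (x \<bullet> y)\<close>, so the potential is a function of the dot
  product; the constant \<open>c\<close> only affects the zeroth derivative.\<close>

definition dot_derivs :: "(nat \<Rightarrow> real \<Rightarrow> real) \<Rightarrow> real \<Rightarrow> nat \<Rightarrow> real \<Rightarrow> real" where
  "dot_derivs F c k s = (- 2) ^ k * F k (2 - 2 * s) - (if k = 0 then c else 0)"

lemma abs_mono_dot_derivs:
  assumes deriv: "\<And>k x. x \<in> {0<..4} \<Longrightarrow> (F k has_real_derivative F (Suc k) x) (at x within {0<..4})"
    and sign: "\<And>k x. x \<in> {0<..4} \<Longrightarrow> 0 \<le> (-1) ^ k * F k x"
  shows "abs_mono (dot_derivs F c)"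
  unfolding abs_mono_def
proof (intro conjI allI ballI impI)
  fix k and t :: real assume t: "t \<in> {-1..<1}"
  have img: "(\<lambda>s. 2 - 2 * s) ` {-1..<1} \<subseteq> {0<..4::real}" by auto
  have "(F k has_real_derivative F (Suc k) (2 - 2 * t)) (at (2 - 2 * t) within {0<..4})"
    using t by (intro deriv) auto
  then have "(F k has_real_derivative F (Suc k) (2 - 2 * t))
      (at (2 - 2 * t) within (\<lambda>s. 2 - 2 * s) ` {-1..<1})"
    using img by (rule DERIV_subset)
  moreover have "((\<lambda>s. 2 - 2 * s) has_real_derivative - 2) (at t within {-1..<1})"
    by (auto intro!: derivative_eq_intros)
  ultimately have "((\<lambda>s. F k (2 - 2 * s)) has_real_derivative F (Suc k) (2 - 2 * t) * - 2)
      (at t within {-1..<1})"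
    using DERIV_image_chain[of "F k" _ "\<lambda>s. 2 - 2 * s"] unfolding o_def by blast
  then show "(dot_derivs F c k has_real_derivative dot_derivs F c (Suc k) t) (at t within {-1..<1})"
    unfolding dot_derivs_def[abs_def] by (auto intro!: derivative_eq_intros)
next
  fix k :: nat and t :: real assume "1 \<le> k" and t: "t \<in> {-1..<1}"
  have "(- 2) ^ k = 2 ^ k * (- 1 :: real) ^ k"
    by (simp add: power_mult_distrib[symmetric])
  then have "dot_derivs F c k t = 2 ^ k * ((- 1) ^ k * F k (2 - 2 * t))"
    using \<open>1 \<le> k\<close> by (simp add: dot_derivs_def)
  then show "0 \<le> dot_derivs F c k t"
    using sign[of "2 - 2 * t" k] t by simp
qed

lemma strict_abs_mono_dot_derivs:
  assumes deriv: "\<And>k x. x \<in> {0<..4} \<Longrightarrow> (F k has_real_derivative F (Suc k) x) (at x within {0<..4})"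
    and sign: "\<And>k x. x \<in> {0<..4} \<Longrightarrow> 0 \<le> (-1) ^ k * F k x"
    and strict: "\<And>k x. x \<in> interior {0<..4} \<Longrightarrow> 0 < (-1) ^ k * F k x"
  shows "strict_abs_mono (dot_derivs F c)"
  unfolding strict_abs_mono_def
proof (intro conjI allI ballI impI abs_mono_dot_derivs deriv sign)
  fix k :: nat and t :: real assume "1 \<le> k" and t: "t \<in> {-1<..<1}"
  have "(- 2) ^ k = 2 ^ k * (- 1 :: real) ^ k"
    by (simp add: power_mult_distrib[symmetric])
  then have "dot_derivs F c k t = 2 ^ k * ((- 1) ^ k * F k (2 - 2 * t))"
    using \<open>1 \<le> k\<close> by (simp add: dot_derivs_def)
  moreover have "{0<..<4} \<subseteq> interior {0<..4::real}"
    by (rule interior_maximal) auto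
  then have "2 - 2 * t \<in> interior {0<..4}" using t by auto
  ultimately show "0 < dot_derivs F c k t"
    using strict[of "2 - 2 * t" k] by simp
qed

section \<open>Potentials on the sphere and their maximum\<close>

lemma p_f_dot:
  fixes x :: "nat \<Rightarrow> real^'n"
  assumes "on_sphere N x" "norm y = 1"
  shows "p_f f N x y = (\<Sum>i<N. f (2 - 2 * (y \<bullet> x i)))"
  unfolding p_f_def
proof (intro sum.cong refl)
  fix i assume "i \<in> {..<N}"
  then have "x i \<bullet> x i = 1" "y \<bullet> y = 1" using assms by (auto simp: on_sphere_def norm_eq_1)
  then have "(norm (y - x i))\<^sup>2 = 2 - 2 * (y \<bullet> x i)"
    by (simp add: power2_norm_eq_inner inner_diff_left inner_diff_right inner_commute[of "x i" y])
  then show "f ((norm (y - x i))\<^sup>2) = f (2 - 2 * (y \<bullet> x i))" by simp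
qed

text \<open>A real \<open>SUP\<close> is meaningful only for bounded sets; this makes
  \<open>Q_f\<close> an actual upper bound.\<close>

lemma bdd_above_p_f:
  fixes x :: "nat \<Rightarrow> real^'n"
  assumes f: "continuous_on {0..4} f" and x: "on_sphere N x"
  shows "bdd_above (p_f f N x ` sphere 0 1)"
proof -
  have "bounded (f ` {0..4})"
    using f by (intro compact_imp_bounded compact_continuous_image) auto
  then obtain B where B: "\<And>t. t \<in> {0..4} \<Longrightarrow> norm (f t) \<le> B"
    unfolding bounded_iff by blast
  show ?thesis
  proof (rule bdd_aboveI2)
    fix y :: "real^'n" assume y: "y \<in> sphere 0 1"
    have "f (2 - 2 * (y \<bullet> x i)) \<le> B" if "i < N" for i
    proof -
      have "\<bar>y \<bullet> x i\<bar> \<le> 1"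
        using Cauchy_Schwarz_ineq2[of y "x i"] y x that by (simp add: on_sphere_def)
      then show ?thesis using B[of "2 - 2 * (y \<bullet> x i)"] by force
    qed
    then have "(\<Sum>i<N. f (2 - 2 * (y \<bullet> x i))) \<le> (\<Sum>i<N. B)"
      by (intro sum_mono) auto
    then show "p_f f N x y \<le> real N * B"
      using p_f_dot[OF x, of y f] y by simp
  qed
qed

context sharp_configuration
begin

lemma energy_le_Q_f:
  fixes f :: "real \<Rightarrow> real"
  assumes f: "continuous_on {0..4} f" and x: "on_sphere N x"
  shows "energy (\<lambda>s. f (2 - 2 * s)) x \<le> real N * Q_f f N x"
proof -
  have "p_f f N x (x k) \<le> Q_f f N x" if "k < N" for k
    unfolding Q_f_def using x that by (intro cSUP_upper bdd_above_p_f f x) (simp add: on_sphere_def)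
  moreover have "p_f f N x (x k) = (\<Sum>j<N. f (2 - 2 * (x k \<bullet> x j)))" if "k < N" for k
    using x that by (intro p_f_dot[OF x]) (simp add: on_sphere_def)
  ultimately have "(\<Sum>j<N. f (2 - 2 * (x k \<bullet> x j))) \<le> Q_f f N x" if "k < N" for k
    using that by metis
  then have "energy (\<lambda>s. f (2 - 2 * s)) x \<le> (\<Sum>k<N. Q_f f N x)"
    unfolding energy_def by (intro sum_mono) auto
  then show ?thesis by simp
qed

lemma Q_f_le_energy:
  fixes f :: "real \<Rightarrow> real"
  assumes sharp': "strongly_m_sharp N b m \<or> antipodal N b"
    and D: "abs_mono D" and g: "continuous_on {-1..1} (\<lambda>s. f (2 - 2 * s))"
      "\<And>t. t \<in> {-1..<1} \<Longrightarrow> f (2 - 2 * t) = D 0 t"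
  shows "real N * Q_f f N b \<le> energy (\<lambda>s. f (2 - 2 * s)) b"
proof -
  have b: "on_sphere N b" by (simp add: on_sphere_def)
  have "Q_f f N b \<le> energy (\<lambda>s. f (2 - 2 * s)) b / real N"
    unfolding Q_f_def
  proof (rule cSUP_least)
    show "sphere (0 :: real^'n) 1 \<noteq> {}" using norm_b[OF N_pos] by force
    fix y :: "real^'n" assume "y \<in> sphere 0 1"
    then have y: "norm y = 1" by simp
    show "p_f f N b y \<le> energy (\<lambda>s. f (2 - 2 * s)) b / real N"
      using potential_bound[OF sharp' D g y] p_f_dot[OF b y, of f] N_pos
      by (simp add: field_simps)
  qed
  then show ?thesis using N_pos by (simp add: field_simps)
qed

end

theorem theorem2p5:
  fixes f :: "real \<Rightarrow> real" and xbar :: "nat \<Rightarrow> real^'n" and N m :: nat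
  assumes "CARD('n) \<ge> 2"
    and "continuous_on {0..4} f"
    and "\<exists>c. completely_monotone_on {0<..4} (\<lambda>t. f t + c)"
    and "m \<ge> 1"
    and "on_sphere N xbar"
    and "strongly_m_sharp N xbar m \<or> (antipodal N xbar \<and> m_sharp N xbar m)"
  shows "(\<forall>x :: nat \<Rightarrow> real^'n. on_sphere N x \<longrightarrow> Q_f f N xbar \<le> Q_f f N x)
    \<and> ((\<exists>c. strictly_completely_monotone_on {0<..4} (\<lambda>t. f t + c)) \<longrightarrow>
        (\<forall>x :: nat \<Rightarrow> real^'n. on_sphere N x \<and> Q_f f N x = Q_f f N xbar \<longrightarrow>
             sharp N x \<and> dot_products N x = dot_products N xbar))"
proof -
  interpret sharp_configuration xbar N m
    using assms by unfold_locales (auto simp: strongly_m_sharp_def)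
  have sharp': "strongly_m_sharp N xbar m \<or> antipodal N xbar" using assms(6) by blast
  define g where "g s = f (2 - 2 * s)" for s
  have g: "continuous_on {-1..1} g"
    unfolding g_def by (rule continuous_on_compose2[OF assms(2)]) (auto intro!: continuous_intros)
  have g_dot: "g t = dot_derivs F c 0 t"
    if "\<And>x. x \<in> {0<..4} \<Longrightarrow> F 0 x = f x + c" "t \<in> {-1..<1}" for F c t
    using that(2) by (simp add: g_def dot_derivs_def that(1))
  obtain c where "completely_monotone_on {0<..4} (\<lambda>t. f t + c)" using assms(3) by blast
  then obtain F where F: "\<And>x. x \<in> {0<..4} \<Longrightarrow> F 0 x = f x + c"
    "\<And>k x. x \<in> {0<..4} \<Longrightarrow> (F k has_real_derivative F (Suc k) x) (at x within {0<..4})"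
    "\<And>k x. x \<in> {0<..4} \<Longrightarrow> 0 \<le> (-1) ^ k * F k x"
    unfolding completely_monotone_on_def by blast
  note D = abs_mono_dot_derivs[where c = c, OF F(2,3)] and gD = g_dot[where F = F and c = c, OF F(1)]
  have upper: "real N * Q_f f N xbar \<le> energy g xbar"
    using Q_f_le_energy[OF sharp' D, of f] g gD unfolding g_def by simp
  have lower: "energy g x \<le> real N * Q_f f N x" if "on_sphere N x" for x :: "nat \<Rightarrow> real^'n"
    using energy_le_Q_f[OF assms(2) that] unfolding g_def .
  show ?thesis
  proof (intro conjI allI impI)
    fix x :: "nat \<Rightarrow> real^'n" assume x: "on_sphere N x"
    have "real N * Q_f f N xbar \<le> real N * Q_f f N x"
      using upper energy_minimal[OF D g gD x] lower[OF x] by linarith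
    then show "Q_f f N xbar \<le> Q_f f N x" using N_pos by simp
  next
    fix x :: "nat \<Rightarrow> real^'n"
    assume "\<exists>c. strictly_completely_monotone_on {0<..4} (\<lambda>t. f t + c)"
      and x: "on_sphere N x \<and> Q_f f N x = Q_f f N xbar"
    then obtain c where "strictly_completely_monotone_on {0<..4} (\<lambda>t. f t + c)" by blast
    \<comment> \<open>The constant for strictness may differ from the one fixed before, so a new
      sequence of derivatives is taken.\<close>
    then obtain F where F: "\<And>x. x \<in> {0<..4} \<Longrightarrow> F 0 x = f x + c"
      "\<And>k x. x \<in> {0<..4} \<Longrightarrow> (F k has_real_derivative F (Suc k) x) (at x within {0<..4})"
      "\<And>k x. x \<in> {0<..4} \<Longrightarrow> 0 \<le> (-1) ^ k * F k x"
      "\<And>k x. x \<in> interior {0<..4} \<Longrightarrow> 0 < (-1) ^ k * F k x"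
      unfolding strictly_completely_monotone_on_def by blast
    note S = strict_abs_mono_dot_derivs[where c = c, OF F(2-4)] and gS = g_dot[where F = F and c = c, OF F(1)]
    \<comment> \<open>Equal maxima close the chain \<open>upper\<close>, minimality,
      \<open>lower\<close> into equalities.\<close>
    have "energy g x = energy g xbar"
      using upper energy_minimal[OF D g gD, of x] lower[of x] x by auto
    then have "\<And>i j. i < N \<Longrightarrow> j < N \<Longrightarrow> i \<noteq> j \<Longrightarrow> x i \<bullet> x j \<in> dots"
      and "\<And>k. k \<le> 2 * m - 1 \<Longrightarrow> gap x (monom 1 k) = 0"
      using energy_equality[OF S g gS] x by blast+
    then have "m_sharp N x m" "dot_products N x = dots"
      using sharp_if_gap_zero x by blast+
    then show "sharp N x" "dot_products N x = dot_products N xbar"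
      using assms(4) by (auto simp: Defs.sharp_def dots_def)
  qed
qed

end
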